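(* Given $n$ i.i.d. samples from the sparse additive model $y_i=\mu+f^*(x_i)+w_i$, $f^*\in\mathcal{F}_{d,s,\mathcal{H}}$ (described in the context), with sparsity $s\le d/4$, there is a universal constant $C>0$ such that: (a) If the univariate class $\mathcal{H}$ has logarithmic metric entropy indexed by a parameter $m>0$, i.e. $\log M(\epsilon;\mathbb{B}_{\mathcal{H}}(1),L^2)\simeq m\log(1/\epsilon)$ for all $\epsilon\in(0,1)$, then $$\mathfrak{M}_{\mathbb{P}}(\mathcal{F}_{d,s,\mathcal{H}})\ \ge\ C\Big\{\frac{s\log(d/s)}{n}+s\,\frac{m}{n}\Big\}\quad\text{with probability greater than } 1/2.$$ (b) If the univariate class $\mathcal{H}$ has polynomial metric entropy indexed by $\alpha>0$, i.e. $\log M(\epsilon;\mathbb{B}_{\mathcal{H}}(1),L^2)\simeq(1/\epsilon)^{1/\alpha}$ for all $\epsilon\in(0,1)$, then $$\mathfrak{M}_{\mathbb{P}}(\mathcal{F}_{d,s,\mathcal{H}})\ \ge\ C\Big\{\frac{s\log(d/s)}{n}+s\Big(\frac1n\Big)^{\frac{2\alpha}{2\alpha+1}}\Big\}\quad\text{with probability greater than } 1/2.$$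
   Context: RKHS. $\mathcal{X}\subset\mathbb{R}$, $\mathbb{Q}$ is a probability measure on $\mathcal{X}$, and $\mathcal{H}\subset L^2(\mathbb{Q})$ is an RKHS of functions on $\mathcal{X}$ with $\int h\,d\mathbb{Q}=0$ for every $h\in\mathcal{H}$. $\mathbb{B}_{\mathcal{H}}(1)$ is its closed unit ball. Function class. For $S\subset\{1,\dots,d\}$, $\mathcal{H}(S)=\{f=\sum_{j\in S}f_j(x_j): f_j\in\mathbb{B}_{\mathcal{H}}(1)\ \forall j\in S\}$, a class of functions on $\mathcal{X}^d$; $\mathcal{F}_{d,s,\mathcal{H}}=\bigcup_{|S|=s}\mathcal{H}(S)$. Model. $\mathbb{P}=\mathbb{Q}^d$ is the product measure on $\mathcal{X}^d$; $x_1,\dots,x_n$ are i.i.d. from $\mathbb{P}$; $w_1,\dots,w_n$ are i.i.d. $N(0,1)$, independent of the $x_i$; $y_i=\mu+f^*(x_i)+w_i$ with $\mu\in\mathbb{R}$. $\|f\|_2=\|f\|_{L^2(\mathbb{P})}$. Minimax error. $\mathfrak{M}_{\mathbb{P}}(\mathcal{F}_{d,s,\mathcal{H}})=\inf_{\widehat f_n}\sup_{f^*\in\mathcal{F}_{d,s,\mathcal{H}}}\|\widehat f_n-f^*\|_2^2$, the infimum being over all measurable functions $\widehat f_n$ of the $n$ samples $\{(x_i,y_i)\}_{i=1}^n$. It is treated as a random quantity, bounded in probability: "$\mathfrak{M}_{\mathbb{P}}\ge r$ with probability greater than $1/2$" means that for every estimator $\widehat f_n$, $\sup_{f^*\in\mathcal{F}_{d,s,\mathcal{H}}}\mathbb{P}_{f^*}[\|\widehat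 f_n-f^*\|_2^2\ge r]>1/2$. Packing entropy. For a totally bounded metric space $(\mathcal{G},\rho)$, an $\epsilon$-packing is a collection $\{f^1,\dots,f^M\}\subset\mathcal{G}$ with $\rho(f^i,f^j)\ge\epsilon$ for all $i\ne j$; $M(\epsilon;\mathcal{G},\rho)$ is the largest cardinality of an $\epsilon$-packing. For $\mathbb{B}_{\mathcal{H}}(1)$ the metric is the $L^2$ distance $\|f-g\|_{L^2(\mathbb{Q})}$. The symbol $\simeq$ means equality up to constant factors. "Universal" constants are independent of $(n,d,s)$.
   Formalization: Proved for log(d/s) ≤ Kn, and m ≤ Kn in (a), for any fixed K>0, with C depending on K, α and the constants in ≃; without such a bound the claim fails, as the zero estimator's error is O(s). Entropy is assumed only for ε<e₀, any e₀≤1, since (a) is contradictory near ε=1. *)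

theory Defs
  imports "HOL-Probability.Probability" "HOL-Library.Extended_Nat"
begin

text \<open>
  A reproducing kernel Hilbert space of real functions on \<open>X\<close>, with inner product \<open>ip\<close>.
  A function on \<open>X\<close> is represented by its extension by \<open>0\<close> to all reals, so that equality of
  functions on \<open>X\<close> is HOL equality; elements of \<open>H\<close> are functions, not almost-everywhere classes.
  The values of \<open>ip\<close> outside \<open>H\<close> are irrelevant.
\<close>

definition ip_norm :: "('f \<Rightarrow> 'f \<Rightarrow> real) \<Rightarrow> 'f \<Rightarrow> real" where
  "ip_norm ip f = sqrt (ip f f)"

locale rkhs =
  fixes X :: "real set"
    and H :: "(real \<Rightarrow> real) set"
    and ip :: "(real \<Rightarrow> real) \<Rightarrow> (real \<Rightarrow> real) \<Rightarrow> real"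
  assumes supported: "f \<in> H \<Longrightarrow> x \<notin> X \<Longrightarrow> f x = 0"
    and zero_mem: "(\<lambda>x. 0) \<in> H"
    and add_mem: "f \<in> H \<Longrightarrow> g \<in> H \<Longrightarrow> (\<lambda>x. f x + g x) \<in> H"
    and scale_mem: "f \<in> H \<Longrightarrow> (\<lambda>x. c * f x) \<in> H"
    and ip_commute: "f \<in> H \<Longrightarrow> g \<in> H \<Longrightarrow> ip f g = ip g f"
    and ip_add_left: "f \<in> H \<Longrightarrow> g \<in> H \<Longrightarrow> h \<in> H \<Longrightarrow> ip (\<lambda>x. f x + g x) h = ip f h + ip g h"
    and ip_scale_left: "f \<in> H \<Longrightarrow> g \<in> H \<Longrightarrow> ip (\<lambda>x. c * f x) g = c * ip f g"
    and ip_nonneg: "f \<in> H \<Longrightarrow> 0 \<le> ip f f"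
    and ip_definite: "f \<in> H \<Longrightarrow> ip f f = 0 \<Longrightarrow> f = (\<lambda>x. 0)"
    and complete:
      "(\<And>k. F k \<in> H) \<Longrightarrow>
       (\<forall>e>0. \<exists>N. \<forall>k\<ge>N. \<forall>l\<ge>N. ip_norm ip (\<lambda>x. F k x - F l x) < e) \<Longrightarrow>
       \<exists>f\<in>H. (\<lambda>k. ip_norm ip (\<lambda>x. F k x - f x)) \<longlonglongrightarrow> 0"
    and reproducing: "x \<in> X \<Longrightarrow> \<exists>k\<in>H. \<forall>f\<in>H. f x = ip f k"

definition unit_ball ::
    "(real \<Rightarrow> real) set \<Rightarrow> ((real \<Rightarrow> real) \<Rightarrow> (real \<Rightarrow> real) \<Rightarrow> real) \<Rightarrow> (real \<Rightarrow> real) set" where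
  "unit_ball H ip = {f \<in> H. ip_norm ip f \<le> 1}"

text \<open>
  The \<open>\<sigma>\<close>-algebra of \<open>Q\<close> is the Borel \<open>\<sigma>\<close>-algebra of the subspace \<open>X\<close>; in particular \<open>space Q = X\<close>.
\<close>

locale centred_rkhs = rkhs X H ip + prob_space Q
  for X :: "real set"
    and H :: "(real \<Rightarrow> real) set"
    and ip :: "(real \<Rightarrow> real) \<Rightarrow> (real \<Rightarrow> real) \<Rightarrow> real"
    and Q :: "real measure" +
  assumes sets_Q: "sets Q = sets (restrict_space borel X)"
    and mem_measurable: "h \<in> H \<Longrightarrow> h \<in> borel_measurable Q"
    and mem_square_integrable: "h \<in> H \<Longrightarrow> integrable Q (\<lambda>x. (h x)\<^sup>2)"
    and mem_centred: "h \<in> H \<Longrightarrow> (\<integral>x. h x \<partial>Q) = 0"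

definition L2_dist :: "'a measure \<Rightarrow> ('a \<Rightarrow> real) \<Rightarrow> ('a \<Rightarrow> real) \<Rightarrow> real" where
  "L2_dist M f g = sqrt (\<integral>x. (f x - g x)\<^sup>2 \<partial>M)"

definition is_packing :: "real \<Rightarrow> 'f set \<Rightarrow> ('f \<Rightarrow> 'f \<Rightarrow> real) \<Rightarrow> 'f set \<Rightarrow> bool" where
  "is_packing \<epsilon> G \<rho> P \<longleftrightarrow>
     finite P \<and> P \<subseteq> G \<and> (\<forall>f\<in>P. \<forall>g\<in>P. f \<noteq> g \<longrightarrow> \<epsilon> \<le> \<rho> f g)"

definition packing_number :: "real \<Rightarrow> 'f set \<Rightarrow> ('f \<Rightarrow> 'f \<Rightarrow> real) \<Rightarrow> enat" where
  "packing_number \<epsilon> G \<rho> = (SUP P\<in>{P. is_packing \<epsilon> G \<rho> P}. enat (card P))"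

text \<open>
  The packing entropy is finite and lies between \<open>c\<^sub>1 \<phi>\<close> and \<open>c\<^sub>2 \<phi>\<close> at all scales in \<open>(0, e\<^sub>0)\<close>.
  The cut-off \<open>e\<^sub>0\<close> is needed for \<open>\<phi> \<epsilon> = m log (1/\<epsilon>)\<close>: with \<open>e\<^sub>0 = 1\<close> the two bounds would give
  \<open>0 < log M(\<epsilon>) < log 2\<close> for \<open>\<epsilon>\<close> close to \<open>1\<close>, which no integer \<open>M(\<epsilon>)\<close> satisfies.
\<close>

definition entropy_order ::
    "real \<Rightarrow> real \<Rightarrow> real \<Rightarrow> 'f set \<Rightarrow> ('f \<Rightarrow> 'f \<Rightarrow> real) \<Rightarrow> (real \<Rightarrow> real) \<Rightarrow> bool" where
  "entropy_order e\<^sub>0 c\<^sub>1 c\<^sub>2 G \<rho> \<phi> \<longleftrightarrow>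
     (\<forall>\<epsilon>\<in>{0<..<e\<^sub>0}. \<exists>M::nat. packing_number \<epsilon> G \<rho> = enat M \<and>
        c\<^sub>1 * \<phi> \<epsilon> \<le> ln (real M) \<and> ln (real M) \<le> c\<^sub>2 * \<phi> \<epsilon>)"

definition log_entropy ::
    "real \<Rightarrow> real \<Rightarrow> real \<Rightarrow> 'f set \<Rightarrow> ('f \<Rightarrow> 'f \<Rightarrow> real) \<Rightarrow> real \<Rightarrow> bool" where
  "log_entropy e\<^sub>0 c\<^sub>1 c\<^sub>2 G \<rho> m \<longleftrightarrow> entropy_order e\<^sub>0 c\<^sub>1 c\<^sub>2 G \<rho> (\<lambda>\<epsilon>. m * ln (1 / \<epsilon>))"

definition poly_entropy ::
    "real \<Rightarrow> real \<Rightarrow> real \<Rightarrow> 'f set \<Rightarrow> ('f \<Rightarrow> 'f \<Rightarrow> real) \<Rightarrow> real \<Rightarrow> bool" where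
  "poly_entropy e\<^sub>0 c\<^sub>1 c\<^sub>2 G \<rho> \<alpha> \<longleftrightarrow> entropy_order e\<^sub>0 c\<^sub>1 c\<^sub>2 G \<rho> (\<lambda>\<epsilon>. (1 / \<epsilon>) powr (1 / \<alpha>))"

text \<open>Points of \<open>X\<^sup>d\<close> are functions on \<open>{1..d}\<close>.\<close>

definition additive_class ::
    "(real \<Rightarrow> real) set \<Rightarrow> nat set \<Rightarrow> ((nat \<Rightarrow> real) \<Rightarrow> real) set" where
  "additive_class B S = {(\<lambda>x. \<Sum>j\<in>S. f j (x j)) | f. \<forall>j\<in>S. f j \<in> B}"

definition sparse_additive_class ::
    "nat \<Rightarrow> nat \<Rightarrow> (real \<Rightarrow> real) set \<Rightarrow> ((nat \<Rightarrow> real) \<Rightarrow> real) set" where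
  "sparse_additive_class d s B = (\<Union>S\<in>{S. S \<subseteq> {1..d} \<and> card S = s}. additive_class B S)"

definition design_measure :: "nat \<Rightarrow> real measure \<Rightarrow> (nat \<Rightarrow> real) measure" where
  "design_measure d Q = PiM {1..d} (\<lambda>_. Q)"

text \<open>Joint law of \<open>(x, \<mu> + f x + w)\<close> with \<open>x\<close> distributed as \<open>P\<close> and \<open>w\<close> an independent \<open>N(0,1)\<close>.\<close>

definition observation_law :: "'a measure \<Rightarrow> real \<Rightarrow> ('a \<Rightarrow> real) \<Rightarrow> ('a \<times> real) measure" where
  "observation_law P \<mu> f =
     distr (P \<Otimes>\<^sub>M density lborel std_normal_density) (P \<Otimes>\<^sub>M borel) (\<lambda>(x, w). (x, \<mu> + f x + w))"

definition sample_law ::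
    "nat \<Rightarrow> 'a measure \<Rightarrow> real \<Rightarrow> ('a \<Rightarrow> real) \<Rightarrow> (nat \<Rightarrow> 'a \<times> real) measure" where
  "sample_law n P \<mu> f = PiM {1..n} (\<lambda>_. observation_law P \<mu> f)"

text \<open>An estimator maps a sample to a function of the design point, jointly measurably.\<close>

definition estimators :: "nat \<Rightarrow> 'a measure \<Rightarrow> ((nat \<Rightarrow> 'a \<times> real) \<Rightarrow> 'a \<Rightarrow> real) set" where
  "estimators n P =
     {fhat. (\<lambda>(z, x). fhat z x) \<in> borel_measurable (PiM {1..n} (\<lambda>_. P \<Otimes>\<^sub>M borel) \<Otimes>\<^sub>M P)}"

text \<open>
  The loss is extended-valued: it is \<open>\<infinity>\<close> when the estimate is not square integrable, whereas the
  Bochner integral would be \<open>0\<close>.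
\<close>

definition sq_loss :: "'a measure \<Rightarrow> ('a \<Rightarrow> real) \<Rightarrow> ('a \<Rightarrow> real) \<Rightarrow> ennreal" where
  "sq_loss P f g = (\<integral>\<^sup>+x. ennreal ((f x - g x)\<^sup>2) \<partial>P)"

definition minimax_ge_whp ::
    "nat \<Rightarrow> 'a measure \<Rightarrow> real \<Rightarrow> ('a \<Rightarrow> real) set \<Rightarrow> real \<Rightarrow> bool" where
  "minimax_ge_whp n P \<mu> F r \<longleftrightarrow>
     (\<forall>fhat\<in>estimators n P.
        (SUP f\<in>F. measure (sample_law n P \<mu> f)
           {z \<in> space (sample_law n P \<mu> f). sq_loss P (fhat z) f \<ge> ennreal r}) > 1 / 2)"

end

theory Submission
  imports Defs
begin

text \<open>
  Two families of well separated functions in the class give the two terms of the bound.  In both,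
  the \<open>d\<close> coordinates contain \<open>s\<close> disjoint blocks and each block carries one letter of an alphabet
  \<open>U\<close>, so a hypothesis is a word of length \<open>s\<close>; since \<open>H\<close> is centred, the blocks are orthogonal in
  \<open>L\<^sup>2\<close> and squared distances are Hamming distances times the separation of letters.  A
  Gilbert--Varshamov code gives \<open>|U| powr (s / 4)\<close> words at Hamming distance at least \<open>s / 2\<close>.
  For \<open>s log (d / s) / n\<close> a letter chooses the active coordinate in a block of size \<open>d div s\<close>; for the
  other term the letters are a local packing of the unit ball, obtained by comparing the packing
  numbers at two scales.  The scales are shrunk until the log likelihood ratios
  have mean at most a fraction of the log number of words, and then no estimator identifies the word
  with probability one half.
\<close>

subsection \<open>Testing many hypotheses in Gaussian regression\<close>

text \<open>Words that differ in one letter are close however large \<open>s\<close> is. Within a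
  code, the separation, the squared norms and the log number of hypotheses are all linear in
  \<open>s\<close>, so \<open>s\<close> cancels and the conditions concern a single letter. The
  entropy bounds have different constants \<open>c\<^sub>1\<close> and \<open>c\<^sub>2\<close>, so
  two scales within a constant factor of each other need not differ in entropy. The scales must be
  far enough apart for the lower bound at the fine one to dominate the upper bound at the coarse
  one. Shrunk functions stay in the unit ball only if the factor is at most 1; this is where
  \<open>ln (d / s) \<le> K n\<close> and \<open>m \<le> K n\<close> enter. The first reflects a
  true limit: for a fixed \<open>H\<close> of L2 radius R, estimating by 0 has squared loss at most
  s R^2, however large log (d / s) / n is. The test needs a fixed amount of log cardinality even for
  \<open>s = 1\<close>. Hence alphabets must have log cardinality at least 16.\<close>

lemma (in prob_space) measure_density_exp_le:
  fixes L :: "'a \<Rightarrow> real"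
  assumes L [measurable]: "L \<in> borel_measurable M"
    and N: "N = density M (\<lambda>x. ennreal (exp (L x)))" "prob_space N"
    and int: "integrable N L"
    and A [measurable]: "A \<in> sets M"
    and t: "1 < t"
  shows "measure N A \<le> exp t * measure M A + (\<integral>x. L x \<partial>N) / (t - 1)"
proof -
  interpret N: prob_space N by fact
  have sets_N [measurable_cong]: "sets N = sets M" by (simp add: N)
  have space_N: "space N = space M" by (simp add: N)
  have int_exp: "integrable N (\<lambda>x. exp (- L x))" "(\<integral>x. exp (- L x) \<partial>N) = 1"
    unfolding N by (simp_all add: integrable_density integral_density flip: exp_add add: prob_space)
  \<comment> \<open>Markov's inequality needs a nonnegative function, and \<open>L\<close> may be
    negative. Adding \<open>exp (- L x) - 1\<close> makes it nonnegative and keeps the mean, because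
    \<open>exp (- L x)\<close> is the density of \<open>M\<close> with respect to \<open>N\<close>
    and integrates to 1.\<close>
  define u where "u x = L x + exp (- L x) - 1" for x
  have u_nonneg: "0 \<le> u x" for x
    using exp_ge_add_one_self[of "- L x"] by (simp add: u_def)
  have int_u: "integrable N u" "(\<integral>x. u x \<partial>N) = (\<integral>x. L x \<partial>N)"
    unfolding u_def using int int_exp by (simp_all add: N.prob_space)
  have "measure N {x\<in>space N. t - 1 \<le> u x} \<le> (\<integral>x. u x \<partial>N) / (t - 1)"
    using t u_nonneg by (intro integral_Markov_inequality_measure[where A = "{}"] int_u) auto
  moreover have "measure N {x\<in>space N. t < L x} \<le> measure N {x\<in>space N. t - 1 \<le> u x}"
    using int_u(1) by (intro N.finite_measure_mono) (auto simp: u_def add_increasing2)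
  ultimately have tail: "measure N {x\<in>space N. t < L x} \<le> (\<integral>x. L x \<partial>N) / (t - 1)"
    using int_u(2) by simp
  let ?B = "A \<inter> {x\<in>space M. L x \<le> t}"
  have "emeasure N ?B = (\<integral>\<^sup>+x. ennreal (exp (L x)) * indicator ?B x \<partial>M)"
    unfolding N by (rule emeasure_density) auto
  also have "\<dots> \<le> (\<integral>\<^sup>+x. ennreal (exp t) * indicator A x \<partial>M)"
    by (intro nn_integral_mono) (auto simp: indicator_def)
  also have "\<dots> = ennreal (exp t) * emeasure M A"
    by (simp add: nn_integral_cmult_indicator)
  finally have "measure N ?B \<le> exp t * measure M A"
    unfolding emeasure_eq_measure N.emeasure_eq_measure
    by (simp flip: ennreal_mult)
  moreover have "measure N A \<le> measure N (?B \<union> {x\<in>space N. t < L x})"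
    using sets.sets_into_space[OF A] by (intro N.finite_measure_mono) (auto simp: space_N)
  moreover have "\<dots> \<le> measure N ?B + measure N {x\<in>space N. t < L x}"
    by (intro measure_Un_le) auto
  ultimately show ?thesis using tail by linarith
qed

text \<open>The log density of N(\<mu> + f(x), 1) with respect to N(\<mu>, 1) at \<open>y\<close>,
  after cancelling the squares of \<open>y - \<mu>\<close>.\<close>

definition obs_log_ratio :: "real \<Rightarrow> ('a \<Rightarrow> real) \<Rightarrow> 'a \<times> real \<Rightarrow> real" where
  "obs_log_ratio \<mu> f = (\<lambda>(x, y). f x * (y - \<mu>) - (f x)\<^sup>2 / 2)"

section \<open>Gaussian likelihood ratios and the testing bound\<close>

context prob_space
begin

lemma prob_space_std_normal: "prob_space (density lborel std_normal_density)"
  by (rule prob_space_normal_density) simp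

lemma sets_observation_law [measurable_cong]:
  "sets (observation_law M \<mu> f) = sets (M \<Otimes>\<^sub>M borel)"
  by (simp add: observation_law_def)

lemma measurable_observation [measurable]:
  assumes [measurable]: "f \<in> borel_measurable M"
  shows "(\<lambda>(x, w). (x, \<mu> + f x + w)) \<in> M \<Otimes>\<^sub>M density lborel std_normal_density \<rightarrow>\<^sub>M M \<Otimes>\<^sub>M borel"
  by measurable

lemma measurable_obs_log_ratio [measurable]:
  assumes [measurable]: "f \<in> borel_measurable M"
  shows "obs_log_ratio \<mu> f \<in> borel_measurable (M \<Otimes>\<^sub>M borel)"
  unfolding obs_log_ratio_def by measurable

lemma prob_space_observation_law:
  assumes [measurable]: "f \<in> borel_measurable M"
  shows "prob_space (observation_law M \<mu> f)"
proof -
  interpret N: prob_space "density lborel std_normal_density" by (rule prob_space_std_normal)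
  interpret pair_prob_space M "density lborel std_normal_density" ..
  show ?thesis
    unfolding observation_law_def by (rule prob_space_distr) measurable
qed

text \<open>The design has the same marginal under both laws, so only the noise matters: for fixed
  \<open>x\<close>, translating \<open>w\<close> by \<open>f x\<close> moves the signal from the
  observation into the Gaussian density.\<close>

lemma observation_law_eq_density:
  assumes f [measurable]: "f \<in> borel_measurable M"
  shows "observation_law M \<mu> f =
    density (observation_law M \<mu> (\<lambda>_. 0)) (\<lambda>z. ennreal (exp (obs_log_ratio \<mu> f z)))" (is "?N = ?D")
proof (rule measure_eqI)
  show "sets ?N = sets ?D" by (simp add: sets_observation_law)
next
  fix B assume "B \<in> sets ?N"
  then have [measurable]: "B \<in> sets (M \<Otimes>\<^sub>M borel)" by (simp add: sets_observation_law)
  interpret N: prob_space "density lborel std_normal_density" by (rule prob_space_std_normal)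
  interpret pair_prob_space M "density lborel std_normal_density" ..
  let ?N = "density lborel (\<lambda>x. ennreal (std_normal_density x))"
  have law: "integral\<^sup>N (observation_law M \<mu> g) h =
      (\<integral>\<^sup>+x. \<integral>\<^sup>+w. ennreal (std_normal_density w) * h (x, \<mu> + g x + w) \<partial>lborel \<partial>M)"
    if [measurable]: "g \<in> borel_measurable M" "h \<in> borel_measurable (M \<Otimes>\<^sub>M borel)" for g h
  proof -
    have "integral\<^sup>N (observation_law M \<mu> g) h =
        (\<integral>\<^sup>+z. h ((\<lambda>(x, w). (x, \<mu> + g x + w)) z) \<partial>(M \<Otimes>\<^sub>M ?N))"
      unfolding observation_law_def by (subst nn_integral_distr) auto
    also have "\<dots> = (\<integral>\<^sup>+x. \<integral>\<^sup>+w. h (x, \<mu> + g x + w) \<partial>?N \<partial>M)"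
      by (subst N.nn_integral_fst[symmetric]) auto
    also have "\<dots> = (\<integral>\<^sup>+x. \<integral>\<^sup>+w. ennreal (std_normal_density w) * h (x, \<mu> + g x + w) \<partial>lborel \<partial>M)"
      by (intro nn_integral_cong, subst nn_integral_density) auto
    finally show ?thesis .
  qed
  have "emeasure (observation_law M \<mu> f) B =
      (\<integral>\<^sup>+x. \<integral>\<^sup>+w. ennreal (std_normal_density w) * indicator B (x, \<mu> + f x + w) \<partial>lborel \<partial>M)"
    using law[of f "indicator B"] by (simp add: sets_observation_law)
  also have "\<dots> = (\<integral>\<^sup>+x. \<integral>\<^sup>+w. ennreal (std_normal_density w) *
      (ennreal (exp (f x * w - (f x)\<^sup>2 / 2)) * indicator B (x, \<mu> + w)) \<partial>lborel \<partial>M)"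
  proof (rule nn_integral_cong)
    fix x assume [measurable]: "x \<in> space M"
    have e: "std_normal_density (w - f x) = std_normal_density w * exp (f x * w - (f x)\<^sup>2 / 2)" for w
    proof -
      have "- (w - f x)\<^sup>2 / 2 = - w\<^sup>2 / 2 + (f x * w - (f x)\<^sup>2 / 2)"
        by (simp add: power2_eq_square field_simps)
      then show ?thesis unfolding std_normal_density_def by (simp only: exp_add mult.assoc)
    qed
    have "(\<integral>\<^sup>+w. ennreal (std_normal_density w) * indicator B (x, \<mu> + f x + w) \<partial>lborel)
      = (\<integral>\<^sup>+w. ennreal (std_normal_density (w - f x)) * indicator B (x, \<mu> + w) \<partial>lborel)"
      by (subst nn_integral_real_affine[where c = 1 and t = "- f x"]) (auto simp: algebra_simps)
    then show "(\<integral>\<^sup>+w. ennreal (std_normal_density w) * indicator B (x, \<mu> + f x + w) \<partial>lborel)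
      = (\<integral>\<^sup>+w. ennreal (std_normal_density w) *
      (ennreal (exp (f x * w - (f x)\<^sup>2 / 2)) * indicator B (x, \<mu> + w)) \<partial>lborel)"
      by (simp add: e ennreal_mult mult.assoc)
  qed
  also have "\<dots> = (\<integral>\<^sup>+z. ennreal (exp (obs_log_ratio \<mu> f z)) * indicator B z \<partial>observation_law M \<mu> (\<lambda>_. 0))"
    using law[of "\<lambda>_. 0" "\<lambda>z. ennreal (exp (obs_log_ratio \<mu> f z)) * indicator B z"]
    by (simp add: obs_log_ratio_def)
  also have "\<dots> = emeasure ?D B"
    by (rule emeasure_density[symmetric]) measurable
  finally show "emeasure (observation_law M \<mu> f) B = emeasure ?D B" .
qed

text \<open>The mean is the Kullback--Leibler divergence of the law with signal \<open>f\<close> from the law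
  with signal \<open>0\<close>.\<close>

lemma expectation_obs_log_ratio:
  assumes f [measurable]: "f \<in> borel_measurable M" and f2: "integrable M (\<lambda>x. (f x)\<^sup>2)"
  shows "has_bochner_integral (observation_law M \<mu> f) (obs_log_ratio \<mu> f) ((\<integral>x. (f x)\<^sup>2 \<partial>M) / 2)"
proof -
  have f1: "integrable M f"
    by (rule square_integrable_imp_integrable[OF f f2])
  interpret N: prob_space "density lborel std_normal_density" by (rule prob_space_std_normal)
  interpret pair_prob_space M "density lborel std_normal_density" ..
  let ?N = "density lborel (\<lambda>x. ennreal (std_normal_density x))"
  have w: "integrable ?N (\<lambda>w. w)" "(\<integral>w. w \<partial>?N) = 0"
    using integrable_std_normal_moment[of 1] integral_std_normal_moment_odd[of 0]
    by (simp_all add: integrable_density integral_density)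
  have sq: "integrable (M \<Otimes>\<^sub>M ?N) (\<lambda>(x, w). (f x)\<^sup>2)"
  proof (rule Fubini_integrable)
    show "integrable M (\<lambda>x. \<integral>w. norm (case (x, w) of (x, w) \<Rightarrow> (f x)\<^sup>2) \<partial>?N)"
      using f2 N.prob_space by simp
    show "AE x in M. integrable ?N (\<lambda>w. case (x, w) of (x, w) \<Rightarrow> (f x)\<^sup>2)" by simp
    show "(\<lambda>(x, w). (f x)\<^sup>2) \<in> borel_measurable (M \<Otimes>\<^sub>M ?N)" by simp
  qed
  have cr: "integrable (M \<Otimes>\<^sub>M ?N) (\<lambda>(x, w). f x * w)"
  proof (rule Fubini_integrable)
    show "integrable M (\<lambda>x. \<integral>w. norm (case (x, w) of (x, w) \<Rightarrow> f x * w) \<partial>?N)"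
      using f1 by (simp add: abs_mult)
    show "AE x in M. integrable ?N (\<lambda>w. case (x, w) of (x, w) \<Rightarrow> f x * w)" using w(1) by simp
    show "(\<lambda>(x, w). f x * w) \<in> borel_measurable (M \<Otimes>\<^sub>M ?N)" by simp
  qed
  have "(\<integral>z. (case z of (x, w) \<Rightarrow> f x * w) \<partial>(M \<Otimes>\<^sub>M ?N)) = (\<integral>x. \<integral>w. f x * w \<partial>?N \<partial>M)"
    using integral_fst[OF cr] by simp
  then have cr0: "(\<integral>z. (case z of (x, w) \<Rightarrow> f x * w) \<partial>(M \<Otimes>\<^sub>M ?N)) = 0"
    using w(2) by simp
  have "(\<integral>z. (case z of (x, w) \<Rightarrow> (f x)\<^sup>2) \<partial>(M \<Otimes>\<^sub>M ?N)) = (\<integral>x. \<integral>w. (f x)\<^sup>2 \<partial>?N \<partial>M)"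
    using integral_fst[OF sq] by simp
  then have sq0: "(\<integral>z. (case z of (x, w) \<Rightarrow> (f x)\<^sup>2) \<partial>(M \<Otimes>\<^sub>M ?N)) = (\<integral>x. (f x)\<^sup>2 \<partial>M)"
    using N.prob_space by simp
  have eq: "obs_log_ratio \<mu> f ((\<lambda>(x, w). (x, \<mu> + f x + w)) z) =
     (case z of (x, w) \<Rightarrow> (f x)\<^sup>2) / 2 + (case z of (x, w) \<Rightarrow> f x * w)" for z
    by (cases z) (simp add: obs_log_ratio_def field_simps power2_eq_square)
  show ?thesis
    unfolding observation_law_def
  proof (rule has_bochner_integral_distr)
    show "has_bochner_integral (M \<Otimes>\<^sub>M ?N)
        (\<lambda>z. obs_log_ratio \<mu> f ((\<lambda>(x, w). (x, \<mu> + f x + w)) z)) ((\<integral>x. (f x)\<^sup>2 \<partial>M) / 2)"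
      unfolding eq has_bochner_integral_iff using sq cr by (simp add: cr0 sq0)
    show "obs_log_ratio \<mu> f \<in> borel_measurable (M \<Otimes>\<^sub>M borel)" by simp
    show "(\<lambda>(x, w). (x, \<mu> + f x + w)) \<in> M \<Otimes>\<^sub>M ?N \<rightarrow>\<^sub>M M \<Otimes>\<^sub>M borel" by simp
  qed
qed

lemma prob_space_sample_law:
  assumes "f \<in> borel_measurable M"
  shows "prob_space (sample_law n M \<mu> f)"
  unfolding sample_law_def using prob_space_observation_law[OF assms] by (rule prob_space_PiM)

lemma sets_sample_law [measurable_cong]:
  "sets (sample_law n M \<mu> f) = sets (PiM {1..n} (\<lambda>_. M \<Otimes>\<^sub>M borel))"
  unfolding sample_law_def by (intro sets_PiM_cong) (auto simp: sets_observation_law)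

lemma space_sample_law:
  "space (sample_law n M \<mu> f) = space (PiM {1..n} (\<lambda>_. M \<Otimes>\<^sub>M borel))"
  by (rule sets_eq_imp_space_eq[OF sets_sample_law])

text \<open>A product measure is determined by its values on rectangles, and there both the
  exponential of the sum and the indicator factor over the observations.\<close>

lemma sample_law_eq_density:
  assumes f [measurable]: "f \<in> borel_measurable M"
  shows "sample_law n M \<mu> f =
    density (sample_law n M \<mu> (\<lambda>_. 0)) (\<lambda>z. ennreal (exp (\<Sum>k\<in>{1..n}. obs_log_ratio \<mu> f (z k))))"
proof -
  let ?Q = "observation_law M \<mu> (\<lambda>_. 0)"
  let ?r = "\<lambda>z. ennreal (exp (obs_log_ratio \<mu> f z))"
  interpret Q: prob_space ?Q by (rule prob_space_observation_law) simp
  interpret R: prob_space "observation_law M \<mu> f" by (rule prob_space_observation_law) simp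
  interpret PQ: product_sigma_finite "\<lambda>_::nat. ?Q" ..
  interpret PR: product_sigma_finite "\<lambda>_::nat. observation_law M \<mu> f" ..
  have r [measurable]: "?r \<in> borel_measurable ?Q" by measurable
  show ?thesis
    unfolding sample_law_def
  proof (rule PR.PiM_eqI[symmetric])
    show "sets (density (PiM {1..n} (\<lambda>_. ?Q)) (\<lambda>z. ennreal (exp (\<Sum>k\<in>{1..n}. obs_log_ratio \<mu> f (z k)))))
        = sets (PiM {1..n} (\<lambda>_. observation_law M \<mu> f))"
      by (simp, intro sets_PiM_cong) (auto simp: sets_observation_law)
  next
    fix A :: "nat \<Rightarrow> ('a \<times> real) set"
    assume A: "\<And>i. i \<in> {1..n} \<Longrightarrow> A i \<in> sets (observation_law M \<mu> f)"
    have A' [measurable]: "\<And>i. i \<in> {1..n} \<Longrightarrow> A i \<in> sets ?Q"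
      using A by (simp add: sets_observation_law)
    have "emeasure (density (PiM {1..n} (\<lambda>_. ?Q))
           (\<lambda>z. ennreal (exp (\<Sum>k\<in>{1..n}. obs_log_ratio \<mu> f (z k))))) (Pi\<^sub>E {1..n} A)
        = (\<integral>\<^sup>+z. ennreal (exp (\<Sum>k\<in>{1..n}. obs_log_ratio \<mu> f (z k))) * indicator (Pi\<^sub>E {1..n} A) z
            \<partial>PiM {1..n} (\<lambda>_. ?Q))"
      by (subst emeasure_density) (auto intro!: sets_PiM_I_finite A')
    also have "\<dots> = (\<integral>\<^sup>+z. (\<Prod>k\<in>{1..n}. ?r (z k) * indicator (A k) (z k)) \<partial>PiM {1..n} (\<lambda>_. ?Q))"
    proof (intro nn_integral_cong)
      fix z assume "z \<in> space (PiM {1..n} (\<lambda>_. ?Q))"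
      then have "(indicator (Pi\<^sub>E {1..n} A) z :: ennreal) = (\<Prod>k\<in>{1..n}. indicator (A k) (z k))"
        by (auto simp: indicator_def space_PiM PiE_iff prod_zero_iff split: if_splits)
      then show "ennreal (exp (\<Sum>k\<in>{1..n}. obs_log_ratio \<mu> f (z k))) * indicator (Pi\<^sub>E {1..n} A) z
         = (\<Prod>k\<in>{1..n}. ?r (z k) * indicator (A k) (z k))"
        by (simp add: exp_sum prod_ennreal prod.distrib)
    qed
    also have "\<dots> = (\<Prod>k\<in>{1..n}. \<integral>\<^sup>+z. ?r z * indicator (A k) z \<partial>?Q)"
      using A' r by (intro PQ.product_nn_integral_prod) auto
    also have "\<dots> = (\<Prod>k\<in>{1..n}. emeasure (density ?Q ?r) (A k))"
      using A' r by (intro prod.cong refl emeasure_density[symmetric])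
    finally show "emeasure (density (PiM {1..n} (\<lambda>_. ?Q))
           (\<lambda>z. ennreal (exp (\<Sum>k\<in>{1..n}. obs_log_ratio \<mu> f (z k))))) (Pi\<^sub>E {1..n} A)
        = (\<Prod>k\<in>{1..n}. emeasure (observation_law M \<mu> f) (A k))"
      by (simp add: observation_law_eq_density[OF f, symmetric])
  qed simp
qed

lemma expectation_sample_log_ratio:
  assumes f [measurable]: "f \<in> borel_measurable M" and f2: "integrable M (\<lambda>x. (f x)\<^sup>2)"
  shows "has_bochner_integral (sample_law n M \<mu> f) (\<lambda>z. \<Sum>k\<in>{1..n}. obs_log_ratio \<mu> f (z k))
    (real n * (\<integral>x. (f x)\<^sup>2 \<partial>M) / 2)"
proof -
  let ?R = "observation_law M \<mu> f"
  have comp: "has_bochner_integral (sample_law n M \<mu> f) (\<lambda>z. obs_log_ratio \<mu> f (z k))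
      ((\<integral>x. (f x)\<^sup>2 \<partial>M) / 2)" if k: "k \<in> {1..n}" for k
  proof -
    have "has_bochner_integral (distr (PiM {1..n} (\<lambda>_. ?R)) ?R (\<lambda>z. z k)) (obs_log_ratio \<mu> f)
        ((\<integral>x. (f x)\<^sup>2 \<partial>M) / 2)"
      using expectation_obs_log_ratio[OF f f2] k
      by (subst distr_PiM_component) (auto intro!: prob_space_observation_law)
    moreover have "(\<lambda>z. z k) \<in> PiM {1..n} (\<lambda>_. ?R) \<rightarrow>\<^sub>M ?R"
      using k by (rule measurable_component_singleton)
    moreover have "obs_log_ratio \<mu> f \<in> borel_measurable ?R" by measurable
    ultimately show ?thesis
      unfolding sample_law_def
      by (simp add: has_bochner_integral_iff integrable_distr_eq integral_distr)
  qed
  have "has_bochner_integral (sample_law n M \<mu> f) (\<lambda>z. \<Sum>k\<in>{1..n}. obs_log_ratio \<mu> f (z k))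
      (\<Sum>k\<in>{1..n}. (\<integral>x. (f x)\<^sup>2 \<partial>M) / 2)"
    by (intro has_bochner_integral_sum comp)
  then show ?thesis by simp
qed

text \<open>Joint measurability of the estimator enters here: integrating out the design point
  leaves a measurable function of the sample, so loss thresholds define events.\<close>

lemma measurable_sq_loss [measurable]:
  assumes "fhat \<in> estimators n M" and [measurable]: "f \<in> borel_measurable M"
  shows "(\<lambda>z. sq_loss M (fhat z) f) \<in> borel_measurable (PiM {1..n} (\<lambda>_. M \<Otimes>\<^sub>M borel))"
proof -
  have [measurable]: "(\<lambda>(z, x). fhat z x) \<in> borel_measurable (PiM {1..n} (\<lambda>_. M \<Otimes>\<^sub>M borel) \<Otimes>\<^sub>M M)"
    using assms(1) by (simp add: estimators_def)
  show ?thesis unfolding sq_loss_def by measurable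
qed

lemma minimax_ge_whp_mono:
  assumes mm: "minimax_ge_whp n M \<mu> F r" and F: "F \<subseteq> borel_measurable M" and r': "r' \<le> r"
  shows "minimax_ge_whp n M \<mu> F r'"
  unfolding minimax_ge_whp_def
proof
  fix fhat assume fhat: "fhat \<in> estimators n M"
  define q where "q r f = measure (sample_law n M \<mu> f)
           {z \<in> space (sample_law n M \<mu> f). sq_loss M (fhat z) f \<ge> ennreal r}" for r f
  have gt: "(SUP f\<in>F. q r f) > 1 / 2"
    using mm fhat by (auto simp: minimax_ge_whp_def q_def)
  have le: "q r f \<le> q r' f" "q r' f \<le> 1" if "f \<in> F" for f
  proof -
    from that F have [measurable]: "f \<in> borel_measurable M" by auto
    interpret S: prob_space "sample_law n M \<mu> f" by (rule prob_space_sample_law) simp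
    note measurable_sq_loss[OF fhat, of f, measurable]
    show "q r f \<le> q r' f"
      unfolding q_def using r' by (intro S.finite_measure_mono) (auto intro: order_trans[OF ennreal_leI])
    show "q r' f \<le> 1" unfolding q_def by simp
  qed
  show "(SUP f\<in>F. q r' f) > 1 / 2"
  \<comment> \<open>Real suprema require a nonempty bounded set. For the empty class both sides are
    the same value \<open>Sup {}\<close>, so the strict bound carries over unchanged.\<close>
  proof (cases "F = {}")
    case True
    with gt show ?thesis by simp
  next
    case False
    have "(SUP f\<in>F. q r f) \<le> (SUP f\<in>F. q r' f)"
      using False le by (intro cSUP_mono) (auto intro!: bdd_aboveI2[where M = 1])
    with gt show ?thesis by linarith
  qed
qed

text \<open>This is the source of the factor 4 in the separation of hypotheses: no estimate is
  within squared loss \<open>r\<close> of two functions at squared distance \<open>4 * r\<close> or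
  more.\<close>

lemma sq_loss_triangle:
  assumes fg: "f \<in> borel_measurable M" "g \<in> borel_measurable M" and h [measurable]: "h \<in> borel_measurable M"
    and "0 \<le> r" and "sq_loss M h f < ennreal r" and "sq_loss M h g < ennreal r"
  shows "sq_loss M f g < ennreal (4 * r)"
proof -
  note fg [measurable]
  have "sq_loss M f g \<le> (\<integral>\<^sup>+x. 2 * ennreal ((h x - f x)\<^sup>2) + 2 * ennreal ((h x - g x)\<^sup>2) \<partial>M)"
    unfolding sq_loss_def
  proof (intro nn_integral_mono)
    fix x
    \<comment> \<open>Parallelogram identity: this square is the gap between the two sides of the
      next inequality.\<close>
    have "0 \<le> ((h x - f x) + (h x - g x))\<^sup>2" by simp
    then have "(f x - g x)\<^sup>2 \<le> 2 * (h x - f x)\<^sup>2 + 2 * (h x - g x)\<^sup>2"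
      by (simp add: power2_eq_square algebra_simps)
    then have "ennreal ((f x - g x)\<^sup>2) \<le> ennreal (2 * (h x - f x)\<^sup>2 + 2 * (h x - g x)\<^sup>2)"
      by (rule ennreal_leI)
    then show "ennreal ((f x - g x)\<^sup>2) \<le> 2 * ennreal ((h x - f x)\<^sup>2) + 2 * ennreal ((h x - g x)\<^sup>2)"
      by (simp add: ennreal_mult ennreal_plus)
  qed
  also have "\<dots> = 2 * sq_loss M h f + 2 * sq_loss M h g"
    unfolding sq_loss_def by (subst nn_integral_add) (auto simp: nn_integral_cmult)
  also have "\<dots> < ennreal (4 * r)"
  proof -
    obtain a where a: "sq_loss M h f = ennreal a" "0 \<le> a"
      using assms(5) by (cases "sq_loss M h f") auto
    obtain b where b: "sq_loss M h g = ennreal b" "0 \<le> b"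
      using assms(6) by (cases "sq_loss M h g") auto
    have "2 * sq_loss M h f + 2 * sq_loss M h g = ennreal (2 * a + 2 * b)"
      using a b by (simp add: ennreal_mult ennreal_plus)
    moreover have "a < r" "b < r"
      using assms(5,6) a b by (auto simp: ennreal_less_iff)
    ultimately show ?thesis using a b by (simp add: ennreal_less_iff del: ennreal_plus)
  qed
  finally show ?thesis .
qed

text \<open>Instead of Fano's inequality: the events that hypothesis \<open>a\<close> is estimated well are disjoint, so
  their probabilities under \<open>f = 0\<close> add up to at most \<open>1\<close>; a change of measure with the likelihood
  ratio truncated at the square root of the number of hypotheses bounds the average success
  probability.\<close>

lemma minimax_ge_whp_of_separated:
  fixes f :: "'i \<Rightarrow> 'a \<Rightarrow> real"
  assumes W: "finite W" and fF: "\<And>a. a \<in> W \<Longrightarrow> f a \<in> F" and F: "F \<subseteq> borel_measurable M"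
    and f2: "\<And>a. a \<in> W \<Longrightarrow> integrable M (\<lambda>x. (f a x)\<^sup>2)"
    and radius: "\<And>a. a \<in> W \<Longrightarrow> real n * (\<integral>x. (f a x)\<^sup>2 \<partial>M) \<le> ln (real (card W)) / 8"
    and card: "4 \<le> ln (real (card W))" and r: "0 \<le> r"
    and sep: "\<And>a b. a \<in> W \<Longrightarrow> b \<in> W \<Longrightarrow> a \<noteq> b \<Longrightarrow> ennreal (4 * r) \<le> sq_loss M (f a) (f b)"
  shows "minimax_ge_whp n M \<mu> F r"
  unfolding minimax_ge_whp_def
proof (intro ballI)
  fix fhat assume fhat: "fhat \<in> estimators n M"
  define P where "P a = sample_law n M \<mu> (f a)" for a
  define P0 where "P0 = sample_law n M \<mu> (\<lambda>_. 0)"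
  define A where "A a = {z \<in> space P0. sq_loss M (fhat z) (f a) < ennreal r}" for a
  define lM where "lM = ln (real (card W))"
  have card_pos: "0 < card W" using card by (cases "card W = 0") auto
  have fm [measurable]: "f a \<in> borel_measurable M" if "a \<in> W" for a
    using fF[OF that] F by auto
  interpret P0: prob_space P0 unfolding P0_def by (rule prob_space_sample_law) simp
  have sets_P0 [measurable_cong]: "sets P0 = sets (PiM {1..n} (\<lambda>_. M \<Otimes>\<^sub>M borel))"
    unfolding P0_def by (rule sets_sample_law)
  have space_P0: "space P0 = space (PiM {1..n} (\<lambda>_. M \<Otimes>\<^sub>M borel))"
    unfolding P0_def by (rule space_sample_law)
  have A_sets: "A a \<in> sets P0" if "a \<in> W" for a
    using measurable_sq_loss[OF fhat fm[OF that]] unfolding A_def by measurable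
  have fhat_m: "fhat z \<in> borel_measurable M" if "z \<in> space P0" for z
  proof -
    have "(\<lambda>(z, x). fhat z x) \<in> borel_measurable (PiM {1..n} (\<lambda>_. M \<Otimes>\<^sub>M borel) \<Otimes>\<^sub>M M)"
      using fhat by (simp add: estimators_def)
    from measurable_Pair2[OF this] that show ?thesis by (simp add: space_P0)
  qed
  have disj: "disjoint_family_on A W"
  proof (unfold disjoint_family_on_def, intro ballI impI)
    fix a b assume ab: "a \<in> W" "b \<in> W" "a \<noteq> b"
    show "A a \<inter> A b = {}"
    proof (rule ccontr)
      assume "A a \<inter> A b \<noteq> {}"
      then obtain z where z: "z \<in> space P0" "sq_loss M (fhat z) (f a) < ennreal r"
        "sq_loss M (fhat z) (f b) < ennreal r" by (auto simp: A_def)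
      from sq_loss_triangle[OF fm[OF ab(1)] fm[OF ab(2)] fhat_m[OF z(1)] r z(2,3)] sep[OF ab]
      show False by simp
    qed
  qed
  have "(\<Sum>a\<in>W. measure P0 (A a)) = measure P0 (\<Union>a\<in>W. A a)"
    using W A_sets disj by (intro P0.finite_measure_finite_Union[symmetric]) auto
  then have sumA: "(\<Sum>a\<in>W. measure P0 (A a)) \<le> 1" by simp
  have bound: "measure (P a) (A a) \<le> exp (lM / 2) * measure P0 (A a) + 1 / 4" if a: "a \<in> W" for a
  proof -
    note fm[OF a, measurable]
    let ?L = "\<lambda>z. \<Sum>k\<in>{1..n}. obs_log_ratio \<mu> (f a) (z k)"
    have L: "has_bochner_integral (P a) ?L (real n * (\<integral>x. (f a x)\<^sup>2 \<partial>M) / 2)"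
      unfolding P_def using a by (intro expectation_sample_log_ratio f2) auto
    have "measure (P a) (A a) \<le> exp (lM / 2) * measure P0 (A a) + (\<integral>z. ?L z \<partial>P a) / (lM / 2 - 1)"
    proof (rule P0.measure_density_exp_le)
      show "?L \<in> borel_measurable P0" by measurable
      show "P a = density P0 (\<lambda>z. ennreal (exp (?L z)))"
        unfolding P_def P0_def by (rule sample_law_eq_density) simp
      show "prob_space (P a)" unfolding P_def by (rule prob_space_sample_law) simp
      show "integrable (P a) ?L" using L by (simp add: has_bochner_integral_iff)
      show "A a \<in> sets P0" by (rule A_sets[OF a])
      show "1 < lM / 2" using card by (simp add: lM_def)
    qed
    also have "(\<integral>z. ?L z \<partial>P a) = real n * (\<integral>x. (f a x)\<^sup>2 \<partial>M) / 2"
      using L by (simp add: has_bochner_integral_iff)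
    \<comment> \<open>The radius condition bounds the mean log ratio by \<open>lM / 16\<close>, and
      \<open>lM \<ge> 4\<close> gives \<open>lM / 2 - 1 \<ge> lM / 4\<close>; the tail term is thus
      at most 1/4.\<close>
    also have "\<dots> / (lM / 2 - 1) \<le> (lM / 16) / (lM / 2 - 1)"
      using radius[OF a] card by (intro divide_right_mono) (auto simp: lM_def)
    also have "\<dots> \<le> 1 / 4"
      using card by (simp add: lM_def field_simps)
    finally show ?thesis by simp
  qed
  have "(\<Sum>a\<in>W. measure (P a) (A a)) \<le> (\<Sum>a\<in>W. exp (lM / 2) * measure P0 (A a) + 1 / 4)"
    by (intro sum_mono bound)
  also have "\<dots> = exp (lM / 2) * (\<Sum>a\<in>W. measure P0 (A a)) + real (card W) / 4"
    by (simp add: sum.distrib sum_distrib_left)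
  also have "\<dots> \<le> exp (lM / 2) * 1 + real (card W) / 4"
    using sumA by (intro add_right_mono mult_left_mono) auto
  \<comment> \<open>Truncating at the square root of \<open>card W\<close> makes the cost of the
    change of measure a small fraction of \<open>card W\<close>: at most \<open>exp (- 2)\<close>,
    which is below 1/4. With the 1/4 from the tails, the average success probability is below
    1/2.\<close>
  also have "exp (lM / 2) = real (card W) * exp (- (lM / 2))"
  proof -
    have "real (card W) = exp (lM / 2) * exp (lM / 2)"
      using card_pos by (simp add: lM_def flip: exp_add)
    then show ?thesis by (simp flip: exp_add)
  qed
  also have "exp (- (lM / 2)) \<le> exp (- 2)"
    using card by (simp add: lM_def)
  also have "exp (- 2 :: real) < 1 / 4"
  proof -
    have "(3 / 2) ^ 4 \<le> exp (1 / 2 :: real) ^ 4"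
      using exp_ge_add_one_self[of "1 / 2"] by (intro power_mono) auto
    then have "4 < exp (2::real)"
      by (simp add: power4_eq_xxxx flip: exp_add)
    then show ?thesis by (simp add: exp_minus field_simps)
  qed
  finally have "(\<Sum>a\<in>W. measure (P a) (A a)) < (\<Sum>a\<in>W. 1 / 2)"
    using card_pos by simp
  then obtain a where a: "a \<in> W" "measure (P a) (A a) < 1 / 2"
    by (meson not_less sum_mono)
  interpret Pa: prob_space "P a"
    unfolding P_def by (rule prob_space_sample_law[OF fm[OF a(1)]])
  have sets_Pa: "sets (P a) = sets P0" "space (P a) = space P0"
    by (simp_all add: P_def sets_P0 sets_sample_law space_P0 space_sample_law)
  have "measure (P a) (space (P a) - A a) = 1 - measure (P a) (A a)"
    using A_sets[OF a(1)] by (intro Pa.prob_compl) (simp add: sets_Pa)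
  moreover have "space (P a) - A a = {z \<in> space (P a). ennreal r \<le> sq_loss M (fhat z) (f a)}"
    by (auto simp: A_def sets_Pa)
  ultimately have "1 / 2 < measure (P a) {z \<in> space (P a). ennreal r \<le> sq_loss M (fhat z) (f a)}"
    using a(2) by simp
  also have "\<dots> \<le> (SUP g\<in>F. measure (sample_law n M \<mu> g)
           {z \<in> space (sample_law n M \<mu> g). ennreal r \<le> sq_loss M (fhat z) g})"
    unfolding P_def
    using F prob_space.prob_le_1[OF prob_space_sample_law]
    by (intro cSUP_upper fF[OF a(1)] bdd_aboveI2[where M = 1]) auto
  finally show "1 / 2 < (SUP f\<in>F. measure (sample_law n M \<mu> f)
           {z \<in> space (sample_law n M \<mu> f). ennreal r \<le> sq_loss M (fhat z) f})" .
qed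

end

subsection \<open>Gilbert--Varshamov codes\<close>

text \<open>A word of the ball is determined by the set of positions where it differs from
  \<open>a\<close> (at most \<open>2 ^ s\<close> choices) and its letters there (at most
  \<open>card U ^ r\<close> choices).\<close>

lemma card_hamming_ball_le:
  assumes U: "finite U" "U \<noteq> {}"
  shows "card {b \<in> {..<s} \<rightarrow>\<^sub>E U. card {k\<in>{..<s}. a k \<noteq> b k} \<le> r} \<le> 2 ^ s * card U ^ r"
proof -
  let ?T = "{T. T \<subseteq> {..<s} \<and> card T \<le> r}"
  let ?B = "\<lambda>T. PiE {..<s} (\<lambda>k. if k \<in> T then U else {a k})"
  have cU: "1 \<le> card U" using U by (simp add: Suc_leI card_gt_0_iff)
  have finT: "finite ?T" by (rule finite_subset[of _ "Pow {..<s}"]) auto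
  have "{b \<in> {..<s} \<rightarrow>\<^sub>E U. card {k\<in>{..<s}. a k \<noteq> b k} \<le> r} \<subseteq> (\<Union>T\<in>?T. ?B T)"
  proof
    fix b assume b: "b \<in> {b \<in> {..<s} \<rightarrow>\<^sub>E U. card {k\<in>{..<s}. a k \<noteq> b k} \<le> r}"
    then have "b \<in> ?B {k\<in>{..<s}. a k \<noteq> b k}" by (auto simp: PiE_iff)
    with b show "b \<in> (\<Union>T\<in>?T. ?B T)" by (intro UN_I[of "{k\<in>{..<s}. a k \<noteq> b k}"]) auto
  qed
  then have "card {b \<in> {..<s} \<rightarrow>\<^sub>E U. card {k\<in>{..<s}. a k \<noteq> b k} \<le> r} \<le> card (\<Union>T\<in>?T. ?B T)"
    using finT U by (intro card_mono finite_UN_I finite_PiE) auto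
  also have "\<dots> \<le> (\<Sum>T\<in>?T. card (?B T))"
    by (rule card_UN_le[OF finT])
  also have "\<dots> \<le> (\<Sum>T\<in>?T. card U ^ r)"
  proof (rule sum_mono)
    fix T assume T: "T \<in> ?T"
    have "card (?B T) = (\<Prod>k\<in>{..<s}. if k \<in> T then card U else 1)"
      by (subst card_PiE) (auto intro!: prod.cong)
    also have "\<dots> = card U ^ card T"
      using T by (simp add: prod.If_cases Int_absorb1)
    also have "\<dots> \<le> card U ^ r"
      using T cU by (intro power_increasing) auto
    finally show "card (?B T) \<le> card U ^ r" .
  qed
  also have "\<dots> \<le> 2 ^ s * card U ^ r"
  proof -
    have "card ?T \<le> card (Pow {..<s})" by (intro card_mono) auto
    then show ?thesis by (simp add: card_Pow)
  qed
  finally show ?thesis .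
qed

text \<open>A code of largest size cannot be extended, so the Hamming balls of radius
  \<open>r\<close> around its words cover all words; the bound on the ball size then gives the
  count.\<close>

lemma gilbert_varshamov:
  assumes U: "finite U" "U \<noteq> {}"
  obtains W where "W \<subseteq> {..<s} \<rightarrow>\<^sub>E U"
    and "\<And>a b. a \<in> W \<Longrightarrow> b \<in> W \<Longrightarrow> a \<noteq> b \<Longrightarrow> r < card {k\<in>{..<s}. a k \<noteq> b k}"
    and "card U ^ s \<le> card W * (2 ^ s * card U ^ r)"
proof -
  let ?Om = "{..<s} \<rightarrow>\<^sub>E U"
  let ?d = "\<lambda>a b. card {k\<in>{..<s}. a k \<noteq> b k}"
  define codes where "codes = {W. W \<subseteq> ?Om \<and> (\<forall>a\<in>W. \<forall>b\<in>W. a \<noteq> b \<longrightarrow> r < ?d a b)}"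
  have finOm: "finite ?Om" using U by (intro finite_PiE) auto
  have "finite codes" unfolding codes_def by (rule finite_subset[of _ "Pow ?Om"]) (auto simp: finOm)
  moreover have "{} \<in> codes" by (simp add: codes_def)
  ultimately have "Max (card ` codes) \<in> card ` codes" by (intro Max_in) auto
  then obtain W where W: "W \<in> codes" and max: "card W = Max (card ` codes)" by auto
  have finW: "finite W" using W finOm finite_subset by (auto simp: codes_def)
  have d_sym: "?d a b = ?d b a" for a b :: "nat \<Rightarrow> 'a"
    by (rule arg_cong[where f = card]) auto
  have "?Om \<subseteq> (\<Union>a\<in>W. {b \<in> ?Om. ?d a b \<le> r})"
  proof
    fix b assume b: "b \<in> ?Om"
    show "b \<in> (\<Union>a\<in>W. {b \<in> ?Om. ?d a b \<le> r})"
    proof (rule ccontr)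
      assume "\<not> ?thesis"
      with b have far: "r < ?d a b" if "a \<in> W" for a using that by (auto simp: not_le)
      have "b \<notin> W" using far[of b] by auto
      have "insert b W \<in> codes"
        using W b far far[unfolded d_sym[of _ b]] by (auto simp: codes_def)
      then have "card (insert b W) \<le> Max (card ` codes)"
        using \<open>finite codes\<close> by (intro Max_ge) auto
      with max \<open>b \<notin> W\<close> finW show False by simp
    qed
  qed
  then have "card ?Om \<le> card (\<Union>a\<in>W. {b \<in> ?Om. ?d a b \<le> r})"
    using finW finOm by (intro card_mono) auto
  also have "\<dots> \<le> (\<Sum>a\<in>W. card {b \<in> ?Om. ?d a b \<le> r})"
    by (rule card_UN_le[OF finW])
  also have "\<dots> \<le> (\<Sum>a\<in>W. 2 ^ s * card U ^ r)"
    by (intro sum_mono card_hamming_ball_le U)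
  finally have "card U ^ s \<le> card W * (2 ^ s * card U ^ r)"
    by (simp add: card_PiE)
  with W show ?thesis by (intro that[of W]) (auto simp: codes_def)
qed

text \<open>Of the total log count \<open>s * ln (card U)\<close>, the letters in a ball of radius
  \<open>s div 2\<close> cost at most a half and the factor \<open>2 ^ s\<close> at most a quarter,
  since \<open>card U \<ge> 2 ^ 4\<close>. A quarter remains.\<close>

lemma gilbert_varshamov_half:
  assumes U: "finite U" "16 \<le> card U"
  obtains W where "W \<subseteq> {..<s} \<rightarrow>\<^sub>E U"
    and "\<And>a b. a \<in> W \<Longrightarrow> b \<in> W \<Longrightarrow> a \<noteq> b \<Longrightarrow> real s / 2 \<le> real (card {k\<in>{..<s}. a k \<noteq> b k})"
    and "real s * ln (real (card U)) / 4 \<le> ln (real (card W))"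
proof -
  have "U \<noteq> {}" using U by auto
  from gilbert_varshamov[OF U(1) this, of s "s div 2"] obtain W where W: "W \<subseteq> {..<s} \<rightarrow>\<^sub>E U"
    and dist: "\<And>a b. a \<in> W \<Longrightarrow> b \<in> W \<Longrightarrow> a \<noteq> b \<Longrightarrow> s div 2 < card {k\<in>{..<s}. a k \<noteq> b k}"
    and card: "card U ^ s \<le> card W * (2 ^ s * card U ^ (s div 2))" by blast
  let ?l = "ln (real (card U))"
  have "0 < card U ^ s" using U by simp
  with card have W0: "0 < card W" by (cases "card W = 0") auto
  have "real (card U) ^ s \<le> real (card W) * (2 ^ s * real (card U) ^ (s div 2))"
    using of_nat_mono[OF card, where 'a = real] by simp
  then have "ln (real (card U) ^ s) \<le> ln (real (card W) * (2 ^ s * real (card U) ^ (s div 2)))"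
    using U W0 by (subst ln_le_cancel_iff) auto
  also have "\<dots> = ln (real (card W)) + real s * ln 2 + real (s div 2) * ?l"
    using U W0 \<open>U \<noteq> {}\<close> by (simp add: ln_mult ln_realpow)
  finally have "real s * ?l \<le> ln (real (card W)) + real s * ln 2 + real (s div 2) * ?l"
    using U by (simp add: ln_realpow)
  moreover have "real (s div 2) * ?l \<le> real s / 2 * ?l"
    using U by (intro mult_right_mono) auto
  moreover have "real s * (4 * ln 2) \<le> real s * ?l"
  proof (rule mult_left_mono)
    have "4 * ln 2 = ln (2 ^ 4 :: real)" by (subst ln_realpow) auto
    also have "\<dots> \<le> ?l" using U by (subst ln_le_cancel_iff) auto
    finally show "4 * ln 2 \<le> ?l" .
  qed simp
  ultimately have "real s * ?l / 4 \<le> ln (real (card W))"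
    by (simp add: field_simps)
  \<comment> \<open>The strict inequality with \<open>s div 2\<close> makes up for the rounding when
    \<open>s\<close> is odd.\<close>
  moreover have "real s / 2 \<le> real (card {k\<in>{..<s}. a k \<noteq> b k})" if "a \<in> W" "b \<in> W" "a \<noteq> b" for a b
    using dist[OF that] by linarith
  ultimately show ?thesis using W that by blast
qed

subsection \<open>Orthogonal blocks of coordinates\<close>

lemma has_bochner_integral_square_sum_orthogonal:
  fixes E :: "'i \<Rightarrow> 'a \<Rightarrow> real"
  assumes K: "finite K"
    and E: "\<And>k l. k \<in> K \<Longrightarrow> l \<in> K \<Longrightarrow>
      has_bochner_integral M (\<lambda>x. E k x * E l x) (if k = l then q k else 0)"
  shows "has_bochner_integral M (\<lambda>x. (\<Sum>k\<in>K. E k x)\<^sup>2) (\<Sum>k\<in>K. q k)"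
proof -
  have "has_bochner_integral M (\<lambda>x. \<Sum>k\<in>K. \<Sum>l\<in>K. E k x * E l x) (\<Sum>k\<in>K. \<Sum>l\<in>K. if k = l then q k else 0)"
    by (intro has_bochner_integral_sum E)
  then show ?thesis
    using K by (simp add: power2_eq_square sum_product)
qed

section \<open>Inner product algebra and operations preserving the unit ball\<close>

lemma (in rkhs) mem_unit_ball_iff: "f \<in> unit_ball H ip \<longleftrightarrow> f \<in> H \<and> ip f f \<le> 1"
  by (auto simp: unit_ball_def ip_norm_def real_sqrt_le_1_iff)

lemma (in rkhs) ip_add_right:
  assumes "f \<in> H" "g \<in> H" "h \<in> H"
  shows "ip h (\<lambda>x. f x + g x) = ip h f + ip h g"
proof -
  have "ip h (\<lambda>x. f x + g x) = ip (\<lambda>x. f x + g x) h"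
    using assms add_mem by (intro ip_commute)
  also have "\<dots> = ip f h + ip g h" using assms by (intro ip_add_left)
  also have "ip f h = ip h f" using assms by (intro ip_commute)
  also have "ip g h = ip h g" using assms by (intro ip_commute)
  finally show ?thesis .
qed

lemma (in rkhs) ip_scale_right:
  assumes "f \<in> H" "g \<in> H"
  shows "ip f (\<lambda>x. c * g x) = c * ip f g"
proof -
  have "ip f (\<lambda>x. c * g x) = ip (\<lambda>x. c * g x) f" using assms scale_mem by (intro ip_commute)
  also have "\<dots> = c * ip g f" using assms by (intro ip_scale_left)
  also have "ip g f = ip f g" using assms by (intro ip_commute)
  finally show ?thesis .
qed

lemma (in rkhs) ip_scale_scale:
  assumes "f \<in> H"
  shows "ip (\<lambda>x. c * f x) (\<lambda>x. c * f x) = c\<^sup>2 * ip f f"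
proof -
  have "ip (\<lambda>x. c * f x) (\<lambda>x. c * f x) = c * ip f (\<lambda>x. c * f x)"
    using assms scale_mem by (intro ip_scale_left)
  also have "ip f (\<lambda>x. c * f x) = c * ip f f" using assms by (intro ip_scale_right)
  finally show ?thesis by (simp add: power2_eq_square)
qed

lemma (in rkhs) ip_add_add:
  assumes "f \<in> H" "g \<in> H"
  shows "ip (\<lambda>x. f x + g x) (\<lambda>x. f x + g x) = ip f f + 2 * ip f g + ip g g"
proof -
  have "ip (\<lambda>x. f x + g x) (\<lambda>x. f x + g x) = ip f (\<lambda>x. f x + g x) + ip g (\<lambda>x. f x + g x)"
    using assms add_mem by (intro ip_add_left)
  also have "ip f (\<lambda>x. f x + g x) = ip f f + ip f g" using assms by (intro ip_add_right)
  also have "ip g (\<lambda>x. f x + g x) = ip g f + ip g g" using assms by (intro ip_add_right)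
  also have "ip g f = ip f g" using assms by (intro ip_commute)
  finally show ?thesis by simp
qed

lemma (in rkhs) scale_mem_unit_ball:
  assumes f: "f \<in> unit_ball H ip" and t: "\<bar>t\<bar> \<le> 1"
  shows "(\<lambda>x. t * f x) \<in> unit_ball H ip"
proof -
  from f have fH: "f \<in> H" "ip f f \<le> 1" by (auto simp: mem_unit_ball_iff)
  have "t\<^sup>2 * ip f f \<le> 1 * 1"
    using t fH ip_nonneg[OF fH(1)] by (intro mult_mono) (auto simp: abs_square_le_1)
  with fH show ?thesis by (simp add: mem_unit_ball_iff ip_scale_scale scale_mem)
qed

lemma (in rkhs) half_diff_mem_unit_ball:
  assumes f: "f \<in> unit_ball H ip" and g: "g \<in> unit_ball H ip"
  shows "(\<lambda>x. (f x - g x) / 2) \<in> unit_ball H ip"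
proof -
  from f g have fH: "f \<in> H" "ip f f \<le> 1" and gH: "g \<in> H" "ip g g \<le> 1"
    by (auto simp: mem_unit_ball_iff)
  define g' where "g' = (\<lambda>x. (- 1) * g x)"
  have g': "g' \<in> H" "ip g' g' = ip g g" "ip f g' = - ip f g"
    unfolding g'_def using scale_mem[OF gH(1), of "- 1"] ip_scale_scale[OF gH(1), of "- 1"]
      ip_scale_right[OF fH(1) gH(1), of "- 1"] by simp_all
  define q where "q = (\<lambda>x. f x + g' x)"
  have q: "q \<in> H" unfolding q_def by (rule add_mem[OF fH(1) g'(1)])
  \<comment> \<open>Nonnegativity of the squared norm of f + g bounds the cross term of f - g,
    without Cauchy--Schwarz.\<close>
  have "0 \<le> ip f f + 2 * ip f g + ip g g"
    using ip_nonneg[OF add_mem[OF fH(1) gH(1)]] ip_add_add[OF fH(1) gH(1)] by simp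
  moreover have "ip q q = ip f f + 2 * ip f g' + ip g' g'"
    unfolding q_def by (rule ip_add_add[OF fH(1) g'(1)])
  ultimately have "ip q q \<le> 4" using fH(2) gH(2) g'(2,3) by linarith
  then have "(\<lambda>x. (1 / 2) * q x) \<in> unit_ball H ip"
    unfolding mem_unit_ball_iff ip_scale_scale[OF q] using scale_mem[OF q, of "1 / 2"]
    by (simp add: power2_eq_square)
  then show ?thesis by (simp add: q_def g'_def)
qed

section \<open>Products over the design and embedding of words\<close>

context centred_rkhs
begin

text \<open>Polarization: \<open>H\<close> is closed under addition, so the square of f + g is
  integrable too.\<close>

lemma integrable_mult_mem:
  assumes "f \<in> H" "g \<in> H"
  shows "integrable Q (\<lambda>x. f x * g x)"
proof -
  have "integrable Q (\<lambda>x. ((f x + g x)\<^sup>2 - (f x)\<^sup>2 - (g x)\<^sup>2) / 2)"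
    using mem_square_integrable[OF assms(1)] mem_square_integrable[OF assms(2)]
      mem_square_integrable[OF add_mem[OF assms]] by auto
  also have "(\<lambda>x. ((f x + g x)\<^sup>2 - (f x)\<^sup>2 - (g x)\<^sup>2) / 2) = (\<lambda>x. f x * g x)"
    by (simp add: power2_eq_square field_simps)
  finally show ?thesis .
qed

lemma integrable_mem: "f \<in> H \<Longrightarrow> integrable Q f"
  using square_integrable_imp_integrable mem_measurable mem_square_integrable by blast

lemma prob_space_design_measure: "prob_space (design_measure d Q)"
  unfolding design_measure_def by (intro prob_space_PiM prob_space_axioms)

lemma has_bochner_integral_coordinates:
  assumes f: "f \<in> H" and g: "g \<in> H" and i: "i \<in> {1..d}" and j: "j \<in> {1..d}"
  shows "has_bochner_integral (design_measure d Q) (\<lambda>x. f (x i) * g (x j))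
    (if i = j then \<integral>x. f x * g x \<partial>Q else 0)"
proof -
  interpret product_sigma_finite "\<lambda>_::nat. Q" ..
  let ?F = "\<lambda>k t. (if k = i then f t else 1) * (if k = j then g t else 1)"
  have int: "integrable Q (?F k)" for k
    using integrable_mem[OF f] integrable_mem[OF g] integrable_mult_mem[OF f g]
    by (cases "k = i"; cases "k = j") simp_all
  have eq: "(\<Prod>k\<in>{1..d}. ?F k (x k)) = f (x i) * g (x j)" for x
    using i j by (simp add: prod.distrib prod.delta)
  have "(\<integral>x. (\<Prod>k\<in>{1..d}. ?F k (x k)) \<partial>design_measure d Q) = (\<Prod>k\<in>{1..d}. integral\<^sup>L Q (?F k))"
    unfolding design_measure_def by (rule product_integral_prod) (use int in auto)
  also have "\<dots> = (if i = j then \<integral>x. f x * g x \<partial>Q else 0)"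
  proof (cases "i = j")
    case True
    have "(\<Prod>k\<in>{1..d}. integral\<^sup>L Q (?F k)) = (\<Prod>k\<in>{1..d}. if k = i then \<integral>x. f x * g x \<partial>Q else 1)"
      using True by (intro prod.cong) (auto simp: prob_space)
    then show ?thesis using True i by simp
  next
    case False
    then have "integral\<^sup>L Q (?F i) = 0" using mem_centred[OF f] by simp
    then have "(\<Prod>k\<in>{1..d}. integral\<^sup>L Q (?F k)) = 0"
      using i by (intro prod_zero bexI[of _ i]) simp_all
    then show ?thesis using False by simp
  qed
  finally have "(\<integral>x. f (x i) * g (x j) \<partial>design_measure d Q) = (if i = j then \<integral>x. f x * g x \<partial>Q else 0)"
    by (simp only: eq)
  moreover have "integrable (design_measure d Q) (\<lambda>x. \<Prod>k\<in>{1..d}. ?F k (x k))"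
    unfolding design_measure_def by (rule product_integrable_prod) (use int in auto)
  then have "integrable (design_measure d Q) (\<lambda>x. f (x i) * g (x j))" by (simp only: eq)
  ultimately show ?thesis by (simp add: has_bochner_integral_iff)
qed

lemma measurable_coordinate:
  assumes "f \<in> H" "j \<in> {1..d}"
  shows "(\<lambda>x. f (x j)) \<in> borel_measurable (design_measure d Q)"
  unfolding design_measure_def using mem_measurable[OF assms(1)] assms(2)
  by (intro measurable_compose[OF measurable_component_singleton])

lemma sparse_additive_class_measurable:
  "sparse_additive_class d s (unit_ball H ip) \<subseteq> borel_measurable (design_measure d Q)"
  unfolding sparse_additive_class_def additive_class_def
  by (auto simp: unit_ball_def intro!: borel_measurable_sum measurable_coordinate)

text \<open>Words index components by blocks, the class by coordinates. Injectivity of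
  \<open>j\<close> lets each used coordinate take the component of its unique block.\<close>

lemma block_sum_mem_sparse_additive_class:
  assumes inj: "inj_on j {..<s}" and j: "j ` {..<s} \<subseteq> {1..d}" and \<phi>: "\<And>k. k < s \<Longrightarrow> \<phi> k \<in> B"
  shows "(\<lambda>x. \<Sum>k<s. \<phi> k (x (j k))) \<in> sparse_additive_class d s B"
proof -
  let ?f = "\<lambda>i. \<phi> (the_inv_into {..<s} j i)"
  have "(\<lambda>x. \<Sum>k<s. \<phi> k (x (j k))) = (\<lambda>x. \<Sum>i\<in>j ` {..<s}. ?f i (x i))"
    using inj by (simp add: sum.reindex the_inv_into_f_f)
  moreover have "\<forall>i\<in>j ` {..<s}. ?f i \<in> B"
    using inj \<phi> by (auto simp: the_inv_into_f_f)
  ultimately have "(\<lambda>x. \<Sum>k<s. \<phi> k (x (j k))) \<in> additive_class B (j ` {..<s})"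
    unfolding additive_class_def by (intro CollectI exI[of _ ?f]) simp
  moreover have "card (j ` {..<s}) = s" using inj by (simp add: card_image)
  ultimately show ?thesis
    using j unfolding sparse_additive_class_def by (intro UN_I[of "j ` {..<s}"]) simp_all
qed

text \<open>Block \<open>k\<close> carries one letter \<open>u\<close>, which selects both the active coordinate \<open>c k u\<close> and the
  component function \<open>\<psi> u\<close>; different blocks use disjoint coordinates and are orthogonal.\<close>

lemma minimax_ge_whp_blocks:
  fixes \<psi> :: "'u \<Rightarrow> real \<Rightarrow> real" and c :: "nat \<Rightarrow> 'u \<Rightarrow> nat"
  assumes U: "finite U" "16 \<le> ln (real (card U))" and s: "1 \<le> s" and e: "0 \<le> e"
    and \<psi>: "\<And>u. u \<in> U \<Longrightarrow> \<psi> u \<in> unit_ball H ip"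
    and c: "\<And>k u. k < s \<Longrightarrow> u \<in> U \<Longrightarrow> c k u \<in> {1..d}"
    and disj: "\<And>k l u v. k < s \<Longrightarrow> l < s \<Longrightarrow> k \<noteq> l \<Longrightarrow> u \<in> U \<Longrightarrow> v \<in> U \<Longrightarrow> c k u \<noteq> c l v"
    and rad: "\<And>u. u \<in> U \<Longrightarrow> real n * (\<integral>x. (\<psi> u x)\<^sup>2 \<partial>Q) \<le> ln (real (card U)) / 32"
    and sep1: "\<And>k u v. k < s \<Longrightarrow> u \<in> U \<Longrightarrow> v \<in> U \<Longrightarrow> u \<noteq> v \<Longrightarrow> c k u = c k v \<Longrightarrow>
      e \<le> (\<integral>x. (\<psi> u x - \<psi> v x)\<^sup>2 \<partial>Q)"
    and sep2: "\<And>k u v. k < s \<Longrightarrow> u \<in> U \<Longrightarrow> v \<in> U \<Longrightarrow> c k u \<noteq> c k v \<Longrightarrow>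
      e \<le> (\<integral>x. (\<psi> u x)\<^sup>2 \<partial>Q) + (\<integral>x. (\<psi> v x)\<^sup>2 \<partial>Q)"
  shows "minimax_ge_whp n (design_measure d Q) \<mu> (sparse_additive_class d s (unit_ball H ip))
    (real s * e / 8)"
proof -
  let ?P = "design_measure d Q"
  interpret P: prob_space ?P by (rule prob_space_design_measure)
  have cU: "16 \<le> card U"
  proof -
    have "exp 16 \<le> real (card U)"
    proof -
      have "0 < card U" using U(2) by (cases "card U = 0") auto
      then have "exp (ln (real (card U))) = real (card U)" by simp
      with U(2) show ?thesis by (metis exp_le_cancel_iff)
    qed
    moreover have "(17::real) \<le> exp 16" using exp_ge_add_one_self[of 16] by simp
    ultimately show ?thesis by linarith
  qed
  from gilbert_varshamov_half[OF U(1) this, of s] obtain W where W: "W \<subseteq> {..<s} \<rightarrow>\<^sub>E U"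
    and dist: "\<And>a b. a \<in> W \<Longrightarrow> b \<in> W \<Longrightarrow> a \<noteq> b \<Longrightarrow> real s / 2 \<le> real (card {k\<in>{..<s}. a k \<noteq> b k})"
    and cW: "real s * ln (real (card U)) / 4 \<le> ln (real (card W))" by blast
  have finW: "finite W" using W U by (meson finite_PiE finite_lessThan finite_subset)
  have aU: "a k \<in> U" if "a \<in> W" "k < s" for a k using that W by auto
  have \<psi>H: "\<psi> u \<in> H" if "u \<in> U" for u using \<psi>[OF that] by (simp add: unit_ball_def)
  define G where "G a k x = \<psi> (a k) (x (c k (a k)))" for a k and x :: "nat \<Rightarrow> real"
  define f where "f a x = (\<Sum>k<s. G a k x)" for a x
  have GG: "has_bochner_integral ?P (\<lambda>x. G a k x * G b l x)
      (if k = l \<and> c k (a k) = c k (b k) then \<integral>x. \<psi> (a k) x * \<psi> (b k) x \<partial>Q else 0)"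
    if ab: "a \<in> W" "b \<in> W" "k < s" "l < s" for a b k l
  proof -
    have "has_bochner_integral ?P (\<lambda>x. \<psi> (a k) (x (c k (a k))) * \<psi> (b l) (x (c l (b l))))
      (if c k (a k) = c l (b l) then \<integral>x. \<psi> (a k) x * \<psi> (b l) x \<partial>Q else 0)"
      using ab aU by (intro has_bochner_integral_coordinates \<psi>H c) auto
    moreover have "k = l" if "c k (a k) = c l (b l)"
      using disj[of k l "a k" "b l"] aU ab that by blast
    ultimately show ?thesis unfolding G_def by (cases "c k (a k) = c l (b l)") auto
  qed
  have norm: "has_bochner_integral ?P (\<lambda>x. (f a x)\<^sup>2) (\<Sum>k<s. \<integral>x. (\<psi> (a k) x)\<^sup>2 \<partial>Q)" if a: "a \<in> W" for a
    unfolding f_def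
  proof (rule has_bochner_integral_square_sum_orthogonal)
    fix k l assume "k \<in> {..<s}" "l \<in> {..<s}"
    then show "has_bochner_integral ?P (\<lambda>x. G a k x * G a l x)
        (if k = l then \<integral>x. (\<psi> (a k) x)\<^sup>2 \<partial>Q else 0)"
      using GG[OF a a, of k l] by (auto simp: power2_eq_square)
  qed simp
  \<comment> \<open>The contribution of block \<open>k\<close> to the squared distance. Letters on
    different coordinates are orthogonal, so their squared norms add up.\<close>
  define q where "q a b k = (if c k (a k) = c k (b k) then \<integral>x. (\<psi> (a k) x - \<psi> (b k) x)\<^sup>2 \<partial>Q
    else (\<integral>x. (\<psi> (a k) x)\<^sup>2 \<partial>Q) + (\<integral>x. (\<psi> (b k) x)\<^sup>2 \<partial>Q))" for a b k
  have diff: "has_bochner_integral ?P (\<lambda>x. (f a x - f b x)\<^sup>2) (\<Sum>k<s. q a b k)" if ab: "a \<in> W" "b \<in> W" for a b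
  proof -
    have "has_bochner_integral ?P (\<lambda>x. (\<Sum>k<s. G a k x - G b k x)\<^sup>2) (\<Sum>k<s. q a b k)"
    proof (rule has_bochner_integral_square_sum_orthogonal)
      fix k l assume kl: "k \<in> {..<s}" "l \<in> {..<s}"
      define I where "I a b k l = (if k = l \<and> c k (a k) = c k (b k) then \<integral>x. \<psi> (a k) x * \<psi> (b k) x \<partial>Q else 0)"
        for a b k l
      have "has_bochner_integral ?P (\<lambda>x. G a k x * G a l x - G a k x * G b l x - G b k x * G a l x + G b k x * G b l x)
          (I a a k l - I a b k l - I b a k l + I b b k l)"
        unfolding I_def using ab kl
        by (intro has_bochner_integral_add has_bochner_integral_diff GG) auto
      also have "(\<lambda>x. G a k x * G a l x - G a k x * G b l x - G b k x * G a l x + G b k x * G b l x) =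
        (\<lambda>x. (G a k x - G b k x) * (G a l x - G b l x))"
        by (simp add: algebra_simps)
      also have "I a a k l - I a b k l - I b a k l + I b b k l = (if k = l then q a b k else 0)"
      proof (cases "k = l \<and> c k (a k) = c k (b k)")
        case True
        have mem: "\<psi> (a k) \<in> H" "\<psi> (b k) \<in> H" using \<psi>H aU ab kl by auto
        have "(\<integral>x. (\<psi> (a k) x - \<psi> (b k) x)\<^sup>2 \<partial>Q) =
           (\<integral>x. \<psi> (a k) x * \<psi> (a k) x - \<psi> (a k) x * \<psi> (b k) x - \<psi> (b k) x * \<psi> (a k) x
             + \<psi> (b k) x * \<psi> (b k) x \<partial>Q)"
          by (simp add: power2_eq_square algebra_simps)
        also have "\<dots> = I a a k l - I a b k l - I b a k l + I b b k l"
          using True[THEN conjunct1, symmetric] True[THEN conjunct2, symmetric] mem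
          by (simp add: I_def integrable_mult_mem mult.commute)
        finally show ?thesis
          using True[THEN conjunct1, symmetric] True[THEN conjunct2] by (simp add: q_def)
      next
        case False
        then show ?thesis by (auto simp: I_def q_def power2_eq_square)
      qed
      finally show "has_bochner_integral ?P (\<lambda>x. (G a k x - G b k x) * (G a l x - G b l x))
        (if k = l then q a b k else 0)" .
    qed simp
    then show ?thesis by (simp add: f_def sum_subtractf)
  qed
  have q_ge: "e \<le> q a b k" if "a \<in> W" "b \<in> W" "k < s" "a k \<noteq> b k" for a b k
    using that aU sep1[of k "a k" "b k"] sep2[of k "a k" "b k"] by (simp add: q_def)
  have q_nonneg: "0 \<le> q a b k" for a b k
    by (simp add: q_def)
  show ?thesis
  proof (rule P.minimax_ge_whp_of_separated[where W = W and f = f])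
    show "finite W" by (rule finW)
    show "sparse_additive_class d s (unit_ball H ip) \<subseteq> borel_measurable ?P"
      by (rule sparse_additive_class_measurable)
    show "f a \<in> sparse_additive_class d s (unit_ball H ip)" if a: "a \<in> W" for a
    proof -
      have "(\<lambda>x. \<Sum>k<s. \<psi> (a k) (x (c k (a k)))) \<in> sparse_additive_class d s (unit_ball H ip)"
      proof (rule block_sum_mem_sparse_additive_class)
        show "inj_on (\<lambda>k. c k (a k)) {..<s}"
        proof (rule inj_onI)
          fix k l assume "k \<in> {..<s}" "l \<in> {..<s}" "c k (a k) = c l (a l)"
          then show "k = l" using disj[of k l "a k" "a l"] aU[OF a] by blast
        qed
        show "(\<lambda>k. c k (a k)) ` {..<s} \<subseteq> {1..d}"
          using c[OF _ aU[OF a]] by blast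
      qed (use \<psi> aU[OF a] in auto)
      then show ?thesis by (simp add: f_def[abs_def] G_def)
    qed
    show "integrable ?P (\<lambda>x. (f a x)\<^sup>2)" if "a \<in> W" for a
      using norm[OF that] by (simp add: has_bochner_integral_iff)
    \<comment> \<open>The code keeps a quarter of the log number of words, so the thresholds 8 and 4
      of the test become 32 and 16 for the alphabet.\<close>
    show "real n * (\<integral>x. (f a x)\<^sup>2 \<partial>?P) \<le> ln (real (card W)) / 8" if a: "a \<in> W" for a
    proof -
      have "real n * (\<integral>x. (f a x)\<^sup>2 \<partial>?P) = (\<Sum>k<s. real n * (\<integral>x. (\<psi> (a k) x)\<^sup>2 \<partial>Q))"
        using norm[OF a] by (simp add: has_bochner_integral_iff sum_distrib_left)
      also have "\<dots> \<le> (\<Sum>k<s. ln (real (card U)) / 32)"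
        using aU[OF a] by (intro sum_mono rad) auto
      finally show ?thesis using cW by simp
    qed
    show "4 \<le> ln (real (card W))"
    proof -
      have "1 * 16 / 4 \<le> real s * ln (real (card U)) / 4"
        using s U(2) by (intro divide_right_mono mult_mono) auto
      with cW show ?thesis by simp
    qed
    show "0 \<le> real s * e / 8" using e by simp
    show "ennreal (4 * (real s * e / 8)) \<le> sq_loss ?P (f a) (f b)"
      if ab: "a \<in> W" "b \<in> W" "a \<noteq> b" for a b
    proof -
      have "4 * (real s * e / 8) = real s / 2 * e" by simp
      also have "\<dots> \<le> real (card {k\<in>{..<s}. a k \<noteq> b k}) * e"
        using dist[OF ab] e by (intro mult_right_mono)
      also have "\<dots> = (\<Sum>k\<in>{k\<in>{..<s}. a k \<noteq> b k}. e)" by simp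
      also have "\<dots> \<le> (\<Sum>k\<in>{k\<in>{..<s}. a k \<noteq> b k}. q a b k)"
        using ab q_ge by (intro sum_mono) auto
      also have "\<dots> \<le> (\<Sum>k<s. q a b k)"
        using q_nonneg by (intro sum_mono2) auto
      finally have "ennreal (4 * (real s * e / 8)) \<le> ennreal (\<Sum>k<s. q a b k)"
        by (rule ennreal_leI)
      also have "\<dots> = sq_loss ?P (f a) (f b)"
        unfolding sq_loss_def using diff[OF ab(1,2)]
        by (subst nn_integral_eq_integral) (auto simp: has_bochner_integral_iff)
      finally show ?thesis .
    qed
  qed
qed

end

subsection \<open>Packings of the unit ball\<close>

text \<open>A finite supremum in \<open>enat\<close> of a nonempty set is possible only for finitely
  many cardinalities, so it is a maximum; the empty packing provides nonemptiness.\<close>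

lemma packing_number_attained:
  assumes "packing_number \<epsilon> G \<rho> = enat M"
  obtains P where "is_packing \<epsilon> G \<rho> P" "card P = M"
proof -
  define A where "A = (\<lambda>P. enat (card P)) ` {P. is_packing \<epsilon> G \<rho> P}"
  have "is_packing \<epsilon> G \<rho> {}" by (simp add: is_packing_def)
  then have ne: "A \<noteq> {}" unfolding A_def by blast
  have Sup: "Sup A = enat M" using assms by (simp add: packing_number_def A_def)
  have "finite A"
    using Sup ne by (cases "finite A") (simp_all add: Sup_enat_def)
  with ne Sup have "Max A = enat M" by (simp add: Sup_enat_def)
  with Max_in[OF \<open>finite A\<close> ne] have "enat M \<in> A" by simp
  with that show ?thesis by (auto simp: A_def)
qed

lemma card_le_packing_number:
  assumes "is_packing \<epsilon> G \<rho> P"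
  shows "enat (card P) \<le> packing_number \<epsilon> G \<rho>"
  unfolding packing_number_def using assms by (intro SUP_upper) simp

text \<open>A maximal \<open>\<eta>\<close>-packing is an \<open>\<eta>\<close>-cover, so by pigeonhole one of its balls contains a large
  part of an \<open>\<epsilon>\<close>-packing.\<close>

lemma local_packing:
  assumes M: "packing_number \<epsilon> G \<rho> = enat M" "0 < M"
    and M': "packing_number \<eta> G \<rho> = enat M'" and \<eta>: "0 < \<eta>"
    and sym: "\<And>f g. \<rho> f g = \<rho> g f" and refl: "\<And>f. \<rho> f f = 0"
  obtains h V where "h \<in> G" and "is_packing \<epsilon> G \<rho> V" and "\<And>f. f \<in> V \<Longrightarrow> \<rho> f h < \<eta>"
    and "M \<le> M' * card V"
proof -
  obtain P where P: "is_packing \<epsilon> G \<rho> P" "card P = M" by (rule packing_number_attained[OF M(1)])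
  obtain P' where P': "is_packing \<eta> G \<rho> P'" "card P' = M'" by (rule packing_number_attained[OF M'])
  have fin: "finite P" "finite P'" and sub: "P \<subseteq> G" "P' \<subseteq> G" using P P' by (auto simp: is_packing_def)
  define V where "V h = {f \<in> P. \<rho> f h < \<eta>}" for h
  have cover: "P \<subseteq> (\<Union>h\<in>P'. V h)"
  proof
    fix f assume f: "f \<in> P"
    show "f \<in> (\<Union>h\<in>P'. V h)"
    proof (rule ccontr)
      assume "\<not> ?thesis"
      with f have far: "\<eta> \<le> \<rho> f h" if "h \<in> P'" for h using that by (auto simp: V_def not_less)
      have "f \<notin> P'" using far[of f] \<eta> refl by auto
      have far': "\<eta> \<le> \<rho> h f" if "h \<in> P'" for h
        using far[OF that] by (simp only: sym[of h f])
      have "is_packing \<eta> G \<rho> (insert f P')"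
        using P'(1) far far' f sub(1) by (auto simp: is_packing_def)
      from card_le_packing_number[OF this] show False
        using M' \<open>f \<notin> P'\<close> fin P'(2) by simp
    qed
  qed
  have "P' \<noteq> {}" using cover P(2) M(2) by auto
  have "card P \<le> card (\<Union>h\<in>P'. V h)"
    using fin cover by (intro card_mono) (auto simp: V_def)
  also have "\<dots> \<le> (\<Sum>h\<in>P'. card (V h))" by (rule card_UN_le[OF fin(2)])
  finally have le: "card P \<le> (\<Sum>h\<in>P'. card (V h))" .
  obtain h where h: "h \<in> P'" "M \<le> M' * card (V h)"
  proof (rule ccontr)
    assume "\<not> thesis"
    with that have lt: "M' * card (V h) < M" if "h \<in> P'" for h using that by (meson not_le)
    have "M' * M \<le> M' * (\<Sum>h\<in>P'. card (V h))" using le P(2) by simp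
    also have "\<dots> = (\<Sum>h\<in>P'. M' * card (V h))" by (simp add: sum_distrib_left)
    also have "\<dots> < (\<Sum>h\<in>P'. M)" using lt fin \<open>P' \<noteq> {}\<close> by (intro sum_strict_mono) auto
    also have "\<dots> = M' * M" using P'(2) by simp
    finally show False by simp
  qed
  have "is_packing \<epsilon> G \<rho> (V h)" using P by (auto simp: is_packing_def V_def)
  moreover have "h \<in> G" using h(1) sub(2) by blast
  moreover have "\<rho> f h < \<eta>" if "f \<in> V h" for f using that by (simp add: V_def)
  ultimately show ?thesis using that h(2) by blast
qed

lemma L2_dist_sym: "L2_dist M f g = L2_dist M g f"
  by (simp add: L2_dist_def power2_commute)

lemma L2_dist_self: "L2_dist M f f = 0"
  by (simp add: L2_dist_def)

lemma L2_dist_power2: "(L2_dist M f g)\<^sup>2 = (\<integral>x. (f x - g x)\<^sup>2 \<partial>M)"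
  by (simp add: L2_dist_def)

section \<open>Lower bounds from one function and from a local packing\<close>

context centred_rkhs
begin

text \<open>Two packing points at distance \<open>D \<ge> 2 * \<gamma>\<close> have half their
  difference in the ball, with L2 norm \<open>D / 2\<close>; shrinking by
  \<open>2 * \<gamma> / D\<close> makes the norm exactly \<open>\<gamma>\<close>.\<close>

lemma unit_ball_element_of_norm:
  assumes M: "packing_number (2 * \<gamma>) (unit_ball H ip) (L2_dist Q) = enat M" "2 \<le> M" and \<gamma>: "0 < \<gamma>"
  obtains g where "g \<in> unit_ball H ip" and "(\<integral>x. (g x)\<^sup>2 \<partial>Q) = \<gamma>\<^sup>2"
proof -
  obtain P where P: "is_packing (2 * \<gamma>) (unit_ball H ip) (L2_dist Q) P" "card P = M"
    by (rule packing_number_attained[OF M(1)])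
  have "2 \<le> card P" using M(2) P(2) by simp
  then obtain f h where fh: "f \<in> P" "h \<in> P" "f \<noteq> h"
    using card_le_Suc0_iff_eq[of P] P(1) by (fastforce simp: is_packing_def)
  then have ball: "f \<in> unit_ball H ip" "h \<in> unit_ball H ip"
    and far: "2 * \<gamma> \<le> L2_dist Q f h" using P(1) by (auto simp: is_packing_def)
  define u where "u x = (f x - h x) / 2" for x
  define D where "D = L2_dist Q f h"
  have u: "u \<in> unit_ball H ip" unfolding u_def by (rule half_diff_mem_unit_ball[OF ball])
  have nu: "(\<integral>x. (u x)\<^sup>2 \<partial>Q) = D\<^sup>2 / 4"
    unfolding u_def D_def by (simp add: L2_dist_power2 power_divide)
  have D: "2 * \<gamma> \<le> D" using far by (simp add: D_def)
  show ?thesis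
  proof
    show "(\<lambda>x. (2 * \<gamma> / D) * u x) \<in> unit_ball H ip"
      using D \<gamma> by (intro scale_mem_unit_ball[OF u]) (simp add: abs_mult)
    show "(\<integral>x. ((2 * \<gamma> / D) * u x)\<^sup>2 \<partial>Q) = \<gamma>\<^sup>2"
      using D \<gamma> by (simp add: power_mult_distrib nu power_divide)
  qed
qed

text \<open>The \<open>d\<close> coordinates are split into \<open>s\<close> blocks of size \<open>d div s\<close>.  The \<open>2^24\<close> multiples of \<open>g\<close>
  only serve to have enough hypotheses when \<open>d / s\<close> is bounded.\<close>

lemma minimax_ge_whp_sparse:
  assumes g: "g \<in> unit_ball H ip" "(\<integral>x. (g x)\<^sup>2 \<partial>Q) = \<gamma>\<^sup>2" and \<gamma>: "0 < \<gamma>" and K: "0 < K"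
    and n: "1 \<le> n" and s: "1 \<le> s" and sd: "real s \<le> real d / 4"
    and lnK: "ln (real d / real s) \<le> K * real n"
  shows "minimax_ge_whp n (design_measure d Q) \<mu> (sparse_additive_class d s (unit_ball H ip))
    (min (1 / 32) (\<gamma>\<^sup>2 / K) / 2 ^ 52 * (real s * ln (real d / real s) / real n))"
proof -
  interpret P: prob_space "design_measure d Q" by (rule prob_space_design_measure)
  define b where "b = d div s"
  \<comment> \<open>The bound 1/32 meets the radius condition of the block construction;
    \<open>\<gamma>\<^sup>2 / K\<close> keeps \<open>\<tau> \<le> 1\<close>, since
    \<open>ln b \<le> K * n\<close>.\<close>
  define \<kappa> where "\<kappa> = min (1 / 32) (\<gamma>\<^sup>2 / K)"
  define N where "N = (2::nat) ^ 24"
  \<comment> \<open>A letter is a position in the block and a multiple of \<open>g\<close>.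
    Multiples start at 1: a zero multiple would not separate letters at different positions.\<close>
  define U where "U = {..<b} \<times> {1..N}"
  define \<tau> where "\<tau> = sqrt (\<kappa> * ln b / (real n * \<gamma>\<^sup>2))"
  define \<psi> where "\<psi> u = (\<lambda>x. (\<tau> * real (snd u) / real N) * g x)" for u :: "nat \<times> nat"
  define c where "c k u = k * b + fst u + 1" for k and u :: "nat \<times> nat"
  have s4: "4 * s \<le> d" using sd by simp
  then have b4: "4 \<le> b" using s by (simp add: b_def less_eq_div_iff_mult_less_eq mult.commute)
  have bs: "s * b \<le> d" by (simp add: b_def)
  have b_le: "real b \<le> real d / real s"
    using bs s by (simp add: field_simps flip: of_nat_mult)
  have "d < s * (b + 1)" using s dividend_less_times_div[of s d] by (simp add: b_def)
  then have "real d < real s * real (b + 1)" by (metis of_nat_less_iff of_nat_mult)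
  then have "real d / real s < real b + 1" using s by (simp add: field_simps)
  \<comment> \<open>Rounding \<open>d / s\<close> down to \<open>b\<close> costs only a factor 2 in
    the logarithm, because \<open>b \<ge> 4\<close>.\<close>
  also have "\<dots> \<le> real b ^ 2"
  proof -
    have "real b + 1 \<le> real b * 4" using b4 by simp
    also have "\<dots> \<le> real b * real b" using b4 by (intro mult_left_mono) auto
    finally show ?thesis by (simp add: power2_eq_square)
  qed
  finally have "ln (real d / real s) \<le> ln (real b ^ 2)"
    using b4 s4 s by (subst ln_le_cancel_iff) auto
  then have ln_b: "ln (real d / real s) \<le> 2 * ln b"
    using b4 by (simp add: ln_realpow)
  have ln_b': "ln b \<le> ln (real d / real s)"
    using b_le b4 s s4 by (subst ln_le_cancel_iff) auto
  have lnb0: "0 \<le> ln b" using b4 by simp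
  have \<kappa>0: "0 < \<kappa>" using \<gamma> K by (simp add: \<kappa>_def)
  have \<kappa>32: "\<kappa> \<le> 1 / 32" unfolding \<kappa>_def by (rule min.cobounded1)
  have N0: "1 \<le> real N" by (simp add: N_def)
  have \<tau>2: "\<tau>\<^sup>2 = \<kappa> * ln b / (real n * \<gamma>\<^sup>2)"
    unfolding \<tau>_def using \<kappa>0 lnb0 by simp
  have n\<tau>: "real n * (\<tau>\<^sup>2 * \<gamma>\<^sup>2) = \<kappa> * ln b"
    unfolding \<tau>2 using n \<gamma> by simp
  have \<tau>0: "0 \<le> \<tau>" unfolding \<tau>_def using \<kappa>0 lnb0 by simp
  have "\<kappa> * ln b \<le> \<gamma>\<^sup>2 / K * (K * real n)"
    using ln_b' lnK lnb0 \<gamma> K by (intro mult_mono) (auto simp: \<kappa>_def)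
  then have "\<kappa> * ln b \<le> real n * \<gamma>\<^sup>2" using K by (simp add: field_simps)
  then have \<tau>1: "\<tau> \<le> 1"
    unfolding \<tau>_def using n \<gamma> by (simp add: divide_le_eq)
  have cardU: "real (card U) = real b * real N" by (simp add: U_def card_cartesian_product)
  have lnU: "ln (real (card U)) = ln b + 24 * ln 2"
  proof -
    have "ln (2 ^ 24 :: real) = 24 * ln 2" by (subst ln_realpow) simp_all
    moreover have "real N = 2 ^ 24" by (simp only: N_def of_nat_power of_nat_numeral)
    ultimately have "ln (real N) = 24 * ln 2" by (simp only:)
    then show ?thesis unfolding cardU using b4 N0 by (simp add: ln_mult)
  qed
  have norm: "(\<integral>x. (t * g x)\<^sup>2 \<partial>Q) = t\<^sup>2 * \<gamma>\<^sup>2" for t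
    by (simp add: power_mult_distrib g(2))
  \<comment> \<open>The squared norm of the smallest multiple, which is also the squared distance of
    consecutive ones.\<close>
  define e where "e = \<tau>\<^sup>2 * \<gamma>\<^sup>2 / (real N)\<^sup>2"
  have e_le: "e \<le> (\<tau> * t / real N)\<^sup>2 * \<gamma>\<^sup>2" if "1 \<le> \<bar>t\<bar>" for t
  proof -
    have "e * 1 \<le> e * t\<^sup>2"
      using that by (intro mult_left_mono) (auto simp: e_def one_le_power abs_le_square_iff[of 1 t, simplified])
    then show ?thesis by (simp add: e_def power_mult_distrib power_divide mult_ac)
  qed
  have "minimax_ge_whp n (design_measure d Q) \<mu> (sparse_additive_class d s (unit_ball H ip))
    (real s * e / 8)"
  proof (rule minimax_ge_whp_blocks[where U = U and \<psi> = \<psi> and c = c])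
    show "finite U" by (simp add: U_def)
    \<comment> \<open>Origin of the exponent 24: \<open>24 * ln 2\<close> is at least 16 whatever
      \<open>b\<close> is.\<close>
    show "16 \<le> ln (real (card U))" unfolding lnU using lnb0 ln2_ge_two_thirds by simp
    show "0 \<le> e" by (simp add: e_def)
    show "\<psi> u \<in> unit_ball H ip" if "u \<in> U" for u
    proof -
      have "snd u \<le> N" using that by (auto simp: U_def)
      then have "\<tau> * (real (snd u) / real N) \<le> 1 * 1"
        using \<tau>0 \<tau>1 N0 by (intro mult_mono) auto
      then show ?thesis
        unfolding \<psi>_def using \<tau>0 by (intro scale_mem_unit_ball[OF g(1)]) simp
    qed
    show "c k u \<in> {1..d}" if "k < s" "u \<in> U" for k u
    proof -
      have "k * b + fst u + 1 \<le> k * b + b" using that by (auto simp: U_def)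
      also have "\<dots> = Suc k * b" by simp
      also have "\<dots> \<le> s * b" using that(1) by (intro mult_right_mono) auto
      finally show ?thesis using bs by (simp add: c_def)
    qed
    show "c k u \<noteq> c l v" if "k < s" "l < s" "k \<noteq> l" "u \<in> U" "v \<in> U" for k l u v
    proof
      assume "c k u = c l v"
      then have "(k * b + fst u) div b = (l * b + fst v) div b" by (simp add: c_def)
      with that b4 show False by (auto simp: U_def)
    qed
    show "real n * (\<integral>x. (\<psi> u x)\<^sup>2 \<partial>Q) \<le> ln (real (card U)) / 32" if "u \<in> U" for u
    proof -
      have "snd u \<le> N" using that by (auto simp: U_def)
      then have "(real (snd u) / real N)\<^sup>2 \<le> 1" using N0 by (simp add: power_le_one)
      then have "(real n * (\<tau>\<^sup>2 * \<gamma>\<^sup>2)) * (real (snd u) / real N)\<^sup>2 \<le> (real n * (\<tau>\<^sup>2 * \<gamma>\<^sup>2)) * 1"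
        by (intro mult_left_mono) auto
      also have "\<dots> \<le> 1 / 32 * ln b"
        unfolding n\<tau> mult_1_right using \<kappa>32 lnb0 by (rule mult_right_mono)
      also have "\<dots> \<le> ln (real (card U)) / 32" unfolding lnU by simp
      finally show ?thesis unfolding \<psi>_def norm by (simp add: power_mult_distrib power_divide mult_ac)
    qed
    show "e \<le> (\<integral>x. (\<psi> u x - \<psi> v x)\<^sup>2 \<partial>Q)" if "u \<in> U" "v \<in> U" "u \<noteq> v" "c k u = c k v" for k u v
    proof -
      have "snd u \<noteq> snd v" using that by (auto simp: c_def prod_eq_iff)
      then have "1 \<le> \<bar>real (snd u) - real (snd v)\<bar>" by linarith
      from e_le[OF this] have "e \<le> (\<integral>x. (\<tau> * (real (snd u) - real (snd v)) / real N * g x)\<^sup>2 \<partial>Q)"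
        unfolding norm .
      also have "(\<lambda>x. \<tau> * (real (snd u) - real (snd v)) / real N * g x) = (\<lambda>x. \<psi> u x - \<psi> v x)"
        by (simp add: \<psi>_def algebra_simps diff_divide_distrib)
      then have "(\<integral>x. (\<tau> * (real (snd u) - real (snd v)) / real N * g x)\<^sup>2 \<partial>Q) = (\<integral>x. (\<psi> u x - \<psi> v x)\<^sup>2 \<partial>Q)"
        by (metis (no_types))
      finally show ?thesis .
    qed
    show "e \<le> (\<integral>x. (\<psi> u x)\<^sup>2 \<partial>Q) + (\<integral>x. (\<psi> v x)\<^sup>2 \<partial>Q)" if "u \<in> U" for u v
    proof -
      have "1 \<le> \<bar>real (snd u)\<bar>" using that by (auto simp: U_def)
      from e_le[OF this] have "e \<le> (\<integral>x. (\<psi> u x)\<^sup>2 \<partial>Q)" unfolding \<psi>_def norm .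
      then show ?thesis by (intro add_increasing2) auto
    qed
  qed (use s in auto)
  \<comment> \<open>The exponent 52 collects 48 from \<open>N\<close> squared, 3 from the division
    by 8, and 1 from rounding \<open>d / s\<close>.\<close>
  moreover have "\<kappa> / 2 ^ 52 * (real s * ln (real d / real s) / real n) \<le> real s * e / 8"
  proof -
    have e: "e = \<kappa> * ln b / real n / 2 ^ 48"
      using n by (simp add: e_def N_def n\<tau>[symmetric])
    have "\<kappa> / 2 ^ 52 * (real s * ln (real d / real s) / real n)
        = \<kappa> * real s / (2 ^ 52 * real n) * ln (real d / real s)" by simp
    also have "\<dots> \<le> \<kappa> * real s / (2 ^ 52 * real n) * (2 * ln b)"
      using ln_b \<kappa>0 by (intro mult_left_mono) auto
    also have "\<dots> = real s * e / 8" unfolding e by simp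
    finally show ?thesis .
  qed
  ultimately show ?thesis
    unfolding \<kappa>_def[symmetric]
    using P.minimax_ge_whp_mono sparse_additive_class_measurable by blast
qed

text \<open>Centring at \<open>h\<close> makes the letters small while keeping them separated, and
  halving keeps them in the ball. Block \<open>k\<close> uses the single coordinate
  \<open>k + 1\<close>, so only letters on a common coordinate have to be compared.\<close>

lemma minimax_ge_whp_local_packing:
  assumes h: "h \<in> unit_ball H ip" and V: "is_packing \<epsilon> (unit_ball H ip) (L2_dist Q) V"
    and near: "\<And>f. f \<in> V \<Longrightarrow> L2_dist Q f h < \<eta>" and \<epsilon>: "0 \<le> \<epsilon>" and \<tau>: "0 \<le> \<tau>" "\<tau> \<le> 1"
    and rad: "8 * real n * (\<tau>\<^sup>2 * \<eta>\<^sup>2) \<le> ln (real (card V))"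
    and card: "16 \<le> ln (real (card V))" and s: "1 \<le> s" "s \<le> d"
  shows "minimax_ge_whp n (design_measure d Q) \<mu> (sparse_additive_class d s (unit_ball H ip))
    (real s * (\<tau>\<^sup>2 * \<epsilon>\<^sup>2 / 4) / 8)"
proof (rule minimax_ge_whp_blocks[where U = V and \<psi> = "\<lambda>f x. \<tau> * ((f x - h x) / 2)" and c = "\<lambda>k _. k + 1"])
  show "finite V" using V by (simp add: is_packing_def)
  show "(\<lambda>x. \<tau> * ((f x - h x) / 2)) \<in> unit_ball H ip" if "f \<in> V" for f
    using V that \<tau> by (intro scale_mem_unit_ball half_diff_mem_unit_ball h) (auto simp: is_packing_def)
  show "real n * (\<integral>x. (\<tau> * ((f x - h x) / 2))\<^sup>2 \<partial>Q) \<le> ln (real (card V)) / 32" if "f \<in> V" for f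
  proof -
    have "0 \<le> L2_dist Q f h" by (simp add: L2_dist_def)
    with near[OF that] have "(L2_dist Q f h)\<^sup>2 \<le> \<eta>\<^sup>2" by (intro power_mono) auto
    then have "real n * \<tau>\<^sup>2 / 4 * (L2_dist Q f h)\<^sup>2 \<le> real n * \<tau>\<^sup>2 / 4 * \<eta>\<^sup>2"
      by (intro mult_left_mono) auto
    with rad show ?thesis by (simp add: power_mult_distrib power_divide L2_dist_power2[symmetric])
  qed
  show "\<tau>\<^sup>2 * \<epsilon>\<^sup>2 / 4 \<le> (\<integral>x. (\<tau> * ((f x - h x) / 2) - \<tau> * ((g x - h x) / 2))\<^sup>2 \<partial>Q)"
    if "f \<in> V" "g \<in> V" "f \<noteq> g" for f g
  proof -
    have "\<tau> * ((f x - h x) / 2) - \<tau> * ((g x - h x) / 2) = \<tau> / 2 * (f x - g x)" for x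
      by (simp add: field_simps)
    then have "(\<integral>x. (\<tau> * ((f x - h x) / 2) - \<tau> * ((g x - h x) / 2))\<^sup>2 \<partial>Q) = \<tau>\<^sup>2 / 4 * (L2_dist Q f g)\<^sup>2"
      by (simp only: power_mult_distrib L2_dist_power2) (simp add: power_divide)
    moreover have "\<epsilon>\<^sup>2 \<le> (L2_dist Q f g)\<^sup>2"
      using V that \<epsilon> by (intro power_mono) (auto simp: is_packing_def)
    then have "\<tau>\<^sup>2 / 4 * \<epsilon>\<^sup>2 \<le> \<tau>\<^sup>2 / 4 * (L2_dist Q f g)\<^sup>2" by (intro mult_left_mono) auto
    ultimately show ?thesis by simp
  qed
qed (use card s in auto)

end

lemma entropy_orderE:
  assumes ent: "entropy_order e\<^sub>0 c\<^sub>1 c\<^sub>2 G \<rho> \<phi>" and \<epsilon>: "0 < \<epsilon>" "\<epsilon> < e\<^sub>0" and pos: "0 < c\<^sub>1" "0 < \<phi> \<epsilon>"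
  obtains M where "packing_number \<epsilon> G \<rho> = enat M" and "2 \<le> M"
    and "c\<^sub>1 * \<phi> \<epsilon> \<le> ln (real M)" and "ln (real M) \<le> c\<^sub>2 * \<phi> \<epsilon>"
proof -
  have "\<epsilon> \<in> {0<..<e\<^sub>0}" using \<epsilon> by simp
  with ent obtain M where M: "packing_number \<epsilon> G \<rho> = enat M"
    "c\<^sub>1 * \<phi> \<epsilon> \<le> ln (real M)" "ln (real M) \<le> c\<^sub>2 * \<phi> \<epsilon>"
    unfolding entropy_order_def by blast
  \<comment> \<open>A positive logarithm excludes 1 and also 0, where \<open>ln\<close> has the
    default value 0.\<close>
  have "0 < ln (real M)" using M(2) mult_pos_pos[OF pos] by linarith
  then have "2 \<le> M" by (cases M; cases "M - 1") auto
  with M that show ?thesis by blast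
qed

text \<open>Only the gap between the two entropies matters: it bounds the log size of the local
  packing from below. Both entropy regimes reduce to choosing \<open>\<epsilon>\<close>,
  \<open>\<eta>\<close> and \<open>\<tau>\<close>.\<close>

lemma (in centred_rkhs) minimax_ge_whp_two_scales:
  assumes M: "packing_number \<epsilon> (unit_ball H ip) (L2_dist Q) = enat M" "2 \<le> M"
    and M': "packing_number \<eta> (unit_ball H ip) (L2_dist Q) = enat M'" "2 \<le> M'"
    and \<epsilon>: "0 < \<epsilon>" and \<eta>: "0 < \<eta>" and \<tau>: "0 \<le> \<tau>" "\<tau> \<le> 1"
    and rad: "8 * real n * (\<tau>\<^sup>2 * \<eta>\<^sup>2) \<le> ln (real M) - ln (real M')"
    and large: "16 \<le> ln (real M) - ln (real M')" and s: "1 \<le> s" "s \<le> d"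
  shows "minimax_ge_whp n (design_measure d Q) \<mu> (sparse_additive_class d s (unit_ball H ip))
    (real s * (\<tau>\<^sup>2 * \<epsilon>\<^sup>2 / 4) / 8)"
proof -
  obtain h V where h: "h \<in> unit_ball H ip" and V: "is_packing \<epsilon> (unit_ball H ip) (L2_dist Q) V"
    and near: "\<And>f. f \<in> V \<Longrightarrow> L2_dist Q f h < \<eta>" and card: "M \<le> M' * card V"
    using local_packing[OF M(1) _ M'(1) \<eta> L2_dist_sym L2_dist_self] M(2) by auto
  have V0: "0 < card V" using card M(2) by (cases "card V = 0") auto
  have "real M \<le> real M' * real (card V)" using card by (metis of_nat_le_iff of_nat_mult)
  then have "ln (real M) \<le> ln (real M' * real (card V))"
    using M(2) M'(2) V0 by (subst ln_le_cancel_iff) auto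
  also have "\<dots> = ln (real M') + ln (real (card V))" using M'(2) V0 by (simp add: ln_mult)
  finally have "ln (real M) - ln (real M') \<le> ln (real (card V))" by simp
  then show ?thesis
    using rad large \<epsilon> by (intro minimax_ge_whp_local_packing[OF h V near _ \<tau> _ _ s]) auto
qed

text \<open>Both scales are constants; the local packing is then shrunk to radius of order \<open>sqrt (m / n)\<close>,
  which is possible because the unit ball is convex and symmetric.\<close>

lemma minimax_log_entropy:
  fixes c\<^sub>1 c\<^sub>2 e\<^sub>0 K :: real
  assumes c: "0 < c\<^sub>1" "0 < c\<^sub>2" and e\<^sub>0: "0 < e\<^sub>0" "e\<^sub>0 \<le> 1" and K: "0 < K"
  obtains C where "0 < C"
    and "\<And>X H ip Q n d s \<mu> m. centred_rkhs X H ip Q \<Longrightarrow> 1 \<le> n \<Longrightarrow> 1 \<le> s \<Longrightarrow> s \<le> d \<Longrightarrow> 0 < m \<Longrightarrow>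
      log_entropy e\<^sub>0 c\<^sub>1 c\<^sub>2 (unit_ball H ip) (L2_dist Q) m \<Longrightarrow> m \<le> K * real n \<Longrightarrow>
      minimax_ge_whp n (design_measure d Q) \<mu> (sparse_additive_class d s (unit_ball H ip))
        (C * (real s * (m / real n)))"
proof -
  define \<eta> where "\<eta> = e\<^sub>0 / 2"
  define l where "l = ln (1 / \<eta>)"
  \<comment> \<open>Then \<open>c\<^sub>1 * L\<close> equals
    \<open>c\<^sub>1 + 26 * c\<^sub>2\<close>, so the entropy at \<open>\<eta> powr L\<close>
    exceeds the one at \<open>\<eta>\<close> by 25 times the upper bound at
    \<open>\<eta>\<close>.\<close>
  define L where "L = 1 + 26 * c\<^sub>2 / c\<^sub>1"
  define \<epsilon> where "\<epsilon> = \<eta> powr L"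
  \<comment> \<open>The first bound gives \<open>\<tau> \<le> 1\<close>, the second fits the squared
    radius \<open>\<tau>\<^sup>2 * \<eta>\<^sup>2\<close> to the entropy gap.\<close>
  define \<kappa> where "\<kappa> = min (1 / K) (25 * c\<^sub>2 * l / (8 * \<eta>\<^sup>2))"
  have \<eta>: "0 < \<eta>" "\<eta> < e\<^sub>0" "\<eta> < 1" using e\<^sub>0 by (auto simp: \<eta>_def)
  have l: "0 < l" using \<eta> by (simp add: l_def)
  have L: "1 \<le> L" using c by (simp add: L_def)
  have "\<epsilon> \<le> \<eta> powr 1" unfolding \<epsilon>_def using \<eta> L by (intro powr_mono') auto
  then have \<epsilon>: "0 < \<epsilon>" "\<epsilon> < e\<^sub>0" using \<eta> by (auto simp: \<epsilon>_def)
  have l_\<epsilon>: "ln (1 / \<epsilon>) = L * l"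
    using \<eta> by (simp add: \<epsilon>_def l_def ln_div ln_powr)
  have \<kappa>: "0 < \<kappa>" using K c l \<eta> by (simp add: \<kappa>_def)
  show ?thesis
  proof
    show "0 < \<kappa> * \<epsilon>\<^sup>2 / 32" using \<kappa> \<epsilon> by simp
  next
    fix X H ip Q and n d s :: nat and \<mu> m :: real
    assume "centred_rkhs X H ip Q"
      and n: "1 \<le> n" and s: "1 \<le> s" "s \<le> d" and m: "0 < m"
      and ent: "log_entropy e\<^sub>0 c\<^sub>1 c\<^sub>2 (unit_ball H ip) (L2_dist Q) m" and mK: "m \<le> K * real n"
    then interpret centred_rkhs X H ip Q by simp
    note ent = ent[unfolded log_entropy_def]
    obtain M where M: "packing_number \<epsilon> (unit_ball H ip) (L2_dist Q) = enat M" "2 \<le> M"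
      "c\<^sub>1 * (m * ln (1 / \<epsilon>)) \<le> ln (real M)"
      by (rule entropy_orderE[OF ent \<epsilon> c(1)]) (use m L l l_\<epsilon> in auto)
    obtain M' where M': "packing_number \<eta> (unit_ball H ip) (L2_dist Q) = enat M'" "2 \<le> M'"
      "ln (real M') \<le> c\<^sub>2 * (m * ln (1 / \<eta>))"
      by (rule entropy_orderE[OF ent \<eta>(1,2) c(1)]) (use m l in \<open>auto simp: l_def\<close>)
    have "c\<^sub>1 * (m * (L * l)) = c\<^sub>1 * (m * l) + 26 * (c\<^sub>2 * (m * l))"
      using c by (simp add: L_def field_simps)
    moreover have "0 < c\<^sub>1 * (m * l)" using c m l by simp
    ultimately have diff: "25 * (c\<^sub>2 * (m * l)) \<le> ln (real M) - ln (real M')"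
      using M(3) M'(3) unfolding l_\<epsilon> l_def[symmetric] by linarith
    \<comment> \<open>This covers small \<open>m\<close>: two separated points at scale
      \<open>\<eta>\<close> force \<open>c\<^sub>2 * (m * l) \<ge> 2 / 3\<close>, and 25 times 2/3
      exceeds 16.\<close>
    have "ln 2 \<le> ln (real M')" using M'(2) by (subst ln_le_cancel_iff) auto
    then have large: "16 \<le> ln (real M) - ln (real M')"
      using diff M'(3) ln2_ge_two_thirds unfolding l_def[symmetric] by linarith
    define \<tau> where "\<tau> = sqrt (\<kappa> * (m / real n))"
    have \<tau>2: "\<tau>\<^sup>2 = \<kappa> * (m / real n)" unfolding \<tau>_def using \<kappa> m by simp
    have "\<kappa> * (m / real n) \<le> 1 / K * K"
      using mK n m K by (intro mult_mono) (auto simp: \<kappa>_def field_simps)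
    then have \<tau>: "0 \<le> \<tau>" "\<tau> \<le> 1" unfolding \<tau>_def using \<kappa> m K by auto
    have "\<kappa> * (8 * \<eta>\<^sup>2 * m) \<le> 25 * c\<^sub>2 * l / (8 * \<eta>\<^sup>2) * (8 * \<eta>\<^sup>2 * m)"
      using m by (intro mult_right_mono) (auto simp: \<kappa>_def)
    also have "\<dots> = 25 * (c\<^sub>2 * (m * l))" using \<eta> by simp
    finally have "8 * real n * (\<tau>\<^sup>2 * \<eta>\<^sup>2) \<le> 25 * (c\<^sub>2 * (m * l))"
      unfolding \<tau>2 using n by (simp add: mult_ac)
    then have rad: "8 * real n * (\<tau>\<^sup>2 * \<eta>\<^sup>2) \<le> ln (real M) - ln (real M')" using diff by linarith
    have "minimax_ge_whp n (design_measure d Q) \<mu> (sparse_additive_class d s (unit_ball H ip))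
        (real s * (\<tau>\<^sup>2 * \<epsilon>\<^sup>2 / 4) / 8)"
      by (rule minimax_ge_whp_two_scales[OF M(1,2) M'(1,2) \<epsilon>(1) \<eta>(1) \<tau> rad large s])
    then show "minimax_ge_whp n (design_measure d Q) \<mu> (sparse_additive_class d s (unit_ball H ip))
        (\<kappa> * \<epsilon>\<^sup>2 / 32 * (real s * (m / real n)))"
      unfolding \<tau>2 by (simp add: mult_ac)
  qed
qed

lemma minimax_poly_entropy:
  fixes c\<^sub>1 c\<^sub>2 e\<^sub>0 \<alpha> :: real
  assumes c: "0 < c\<^sub>1" "0 < c\<^sub>2" and e\<^sub>0: "0 < e\<^sub>0" and \<alpha>: "0 < \<alpha>"
  obtains C where "0 < C"
    and "\<And>X H ip Q n d s \<mu>. centred_rkhs X H ip Q \<Longrightarrow> 1 \<le> n \<Longrightarrow> 1 \<le> s \<Longrightarrow> s \<le> d \<Longrightarrow>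
      poly_entropy e\<^sub>0 c\<^sub>1 c\<^sub>2 (unit_ball H ip) (L2_dist Q) \<alpha> \<Longrightarrow>
      minimax_ge_whp n (design_measure d Q) \<mu> (sparse_additive_class d s (unit_ball H ip))
        (C * (real s * (1 / real n) powr (2 * \<alpha> / (2 * \<alpha> + 1))))"
proof -
  \<comment> \<open>Ratio of the scales: it makes the upper entropy bound at
    \<open>D * \<epsilon>\<close> at most half the lower bound at \<open>\<epsilon>\<close>.\<close>
  define D where "D = (1 + 2 * c\<^sub>2 / c\<^sub>1) powr \<alpha>"
  \<comment> \<open>The entropy gap is at least \<open>c\<^sub>1 * T * w / 2\<close>. The first
    entry makes this at least 16, the second lets it dominate the squared radius.\<close>
  define T where "T = max (32 / c\<^sub>1) (16 * D\<^sup>2 / c\<^sub>1)"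
  \<comment> \<open>Here \<open>e\<^sub>0 / (2 * D)\<close> keeps the coarse scale below
    \<open>e\<^sub>0\<close> for every \<open>n\<close>, and \<open>T powr (- \<alpha>)\<close>
    raises the entropy at \<open>\<epsilon>\<close> to at least \<open>T * w\<close>.\<close>
  define \<kappa> where "\<kappa> = min (min 1 (e\<^sub>0 / (2 * D))) (T powr (- \<alpha>))"
  have D: "1 \<le> D" unfolding D_def using c \<alpha> by (intro ge_one_powr_ge_zero) auto
  have T: "0 < T" using c by (simp add: T_def less_max_iff_disj)
  have \<kappa>: "0 < \<kappa>" "\<kappa> \<le> 1" "\<kappa> \<le> e\<^sub>0 / (2 * D)" "\<kappa> \<le> T powr (- \<alpha>)"
    using e\<^sub>0 D T by (auto simp: \<kappa>_def)
  have "T powr (- \<alpha>) = 1 / T powr \<alpha>" by (simp add: powr_minus_divide)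
  with \<kappa> T have "T powr \<alpha> \<le> 1 / \<kappa>" by (simp add: field_simps)
  then have "(T powr \<alpha>) powr (1 / \<alpha>) \<le> (1 / \<kappa>) powr (1 / \<alpha>)"
    using \<alpha> by (intro powr_mono2) auto
  then have \<kappa>T: "T \<le> (1 / \<kappa>) powr (1 / \<alpha>)" using T \<alpha> by (simp add: powr_powr)
  show ?thesis
  proof
    show "0 < \<kappa>\<^sup>2 / 32" using \<kappa> by simp
  next
    fix X H ip Q and n d s :: nat and \<mu> :: real
    assume "centred_rkhs X H ip Q"
      and n: "1 \<le> n" and s: "1 \<le> s" "s \<le> d"
      and ent: "poly_entropy e\<^sub>0 c\<^sub>1 c\<^sub>2 (unit_ball H ip) (L2_dist Q) \<alpha>"
    then interpret centred_rkhs X H ip Q by simp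
    note ent = ent[unfolded poly_entropy_def]
    define p where "p = (1 / real n) powr (\<alpha> / (2 * \<alpha> + 1))"
    define \<epsilon> where "\<epsilon> = \<kappa> * p"
    define \<eta> where "\<eta> = D * \<epsilon>"
    define w where "w = (1 / p) powr (1 / \<alpha>)"
    have p: "0 < p" "p \<le> 1" using n \<alpha> by (auto simp: p_def powr_le1)
    have p2: "p\<^sup>2 = (1 / real n) powr (2 * \<alpha> / (2 * \<alpha> + 1))"
      using n by (simp add: p_def powr_powr mult.commute flip: powr_realpow)
    have w_eq: "w = real n powr (1 / (2 * \<alpha> + 1))"
      using n \<alpha> by (simp add: w_def p_def powr_divide powr_powr)
    have w1: "1 \<le> w" unfolding w_eq using n \<alpha> by (intro ge_one_powr_ge_zero) auto
    \<comment> \<open>The balance that fixes the exponent of \<open>p\<close>, \<open>w\<close>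
      being \<open>p\<close> to the power -1/\<alpha>.\<close>
    have np: "real n * p\<^sup>2 = w"
    proof -
      have "real n * p\<^sup>2 = real n powr 1 * real n powr (- (2 * \<alpha> / (2 * \<alpha> + 1)))"
        using n unfolding p2 by (simp add: powr_divide powr_minus_divide)
      also have "\<dots> = real n powr (1 / (2 * \<alpha> + 1))"
        unfolding powr_add[symmetric] using \<alpha> by (simp add: field_simps)
      finally show ?thesis by (simp add: w_eq)
    qed
    have \<epsilon>: "0 < \<epsilon>" using \<kappa> p by (simp add: \<epsilon>_def)
    have "\<eta> \<le> D * \<kappa>" unfolding \<eta>_def \<epsilon>_def using \<kappa> p D by (simp add: mult_left_le)
    also have "\<dots> \<le> D * (e\<^sub>0 / (2 * D))" using \<kappa> D by (intro mult_left_mono) auto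
    also have "\<dots> < e\<^sub>0" using D e\<^sub>0 by simp
    finally have \<eta>: "0 < \<eta>" "\<eta> < e\<^sub>0" using \<epsilon> D by (auto simp: \<eta>_def)
    have "\<epsilon> \<le> \<eta>" unfolding \<eta>_def using D \<epsilon> by (simp add: mult_le_cancel_right1)
    with \<eta> have \<epsilon>e: "\<epsilon> < e\<^sub>0" by simp
    define \<Phi> where "\<Phi> = (1 / \<epsilon>) powr (1 / \<alpha>)"
    have \<Phi>: "\<Phi> = (1 / \<kappa>) powr (1 / \<alpha>) * w"
      unfolding \<Phi>_def \<epsilon>_def w_def using \<kappa> p by (simp add: powr_mult[symmetric])
    have \<Phi>T: "T * w \<le> \<Phi>" unfolding \<Phi> using \<kappa>T w1 by (intro mult_right_mono) auto
    have \<Phi>\<eta>: "(1 / \<eta>) powr (1 / \<alpha>) = \<Phi> / (1 + 2 * c\<^sub>2 / c\<^sub>1)"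
    proof -
      have "D powr (1 / \<alpha>) = 1 + 2 * c\<^sub>2 / c\<^sub>1"
        unfolding D_def using \<alpha> c by (simp add: powr_powr)
      then show ?thesis
        unfolding \<eta>_def \<Phi>_def using D \<epsilon> by (simp add: powr_divide powr_mult)
    qed
    obtain M where M: "packing_number \<epsilon> (unit_ball H ip) (L2_dist Q) = enat M" "2 \<le> M"
      "c\<^sub>1 * \<Phi> \<le> ln (real M)"
      unfolding \<Phi>_def by (rule entropy_orderE[OF ent \<epsilon> \<epsilon>e c(1)]) (use \<epsilon> in auto)
    obtain M' where M': "packing_number \<eta> (unit_ball H ip) (L2_dist Q) = enat M'" "2 \<le> M'"
      "ln (real M') \<le> c\<^sub>2 * (\<Phi> / (1 + 2 * c\<^sub>2 / c\<^sub>1))"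
      unfolding \<Phi>\<eta>[symmetric] by (rule entropy_orderE[OF ent \<eta> c(1)]) (use \<eta> in auto)
    have \<Phi>0: "0 \<le> \<Phi>" by (simp add: \<Phi>_def)
    have "c\<^sub>2 * (\<Phi> / (1 + 2 * c\<^sub>2 / c\<^sub>1)) = (c\<^sub>1 * \<Phi>) * (c\<^sub>2 / (c\<^sub>1 + 2 * c\<^sub>2))"
      using c by (simp add: field_simps)
    also have "\<dots> \<le> (c\<^sub>1 * \<Phi>) * (1 / 2)"
      using c \<Phi>0 by (intro mult_left_mono) (auto simp: field_simps)
    finally have "ln (real M') \<le> (c\<^sub>1 * \<Phi>) * (1 / 2)"
      by (rule order_trans[OF M'(3)])
    with M(3) have diff: "c\<^sub>1 * \<Phi> / 2 \<le> ln (real M) - ln (real M')" by linarith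
    have c\<Phi>: "c\<^sub>1 * (T * w) \<le> c\<^sub>1 * \<Phi>" using \<Phi>T c by (intro mult_left_mono) auto
    have "32 \<le> c\<^sub>1 * T" using c by (simp add: T_def max_def field_simps)
    then have "32 * 1 \<le> c\<^sub>1 * T * w" using w1 by (intro mult_mono) auto
    then have large: "16 \<le> ln (real M) - ln (real M')" using diff c\<Phi> by (simp add: mult_ac)
    have rad: "8 * real n * (1\<^sup>2 * \<eta>\<^sup>2) \<le> ln (real M) - ln (real M')"
    proof -
      have "8 * real n * (1\<^sup>2 * \<eta>\<^sup>2) = 8 * D\<^sup>2 * w * \<kappa>\<^sup>2"
        unfolding \<eta>_def \<epsilon>_def np[symmetric] by (simp add: power_mult_distrib)
      also have "\<dots> \<le> 8 * D\<^sup>2 * w * 1"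
        using \<kappa> w1 by (intro mult_left_mono) (auto simp: power_le_one)
      also have "\<dots> \<le> c\<^sub>1 * (T * w) / 2"
      proof -
        have "16 * D\<^sup>2 \<le> c\<^sub>1 * T" using c by (simp add: T_def max_def field_simps)
        then have "16 * D\<^sup>2 * w \<le> c\<^sub>1 * T * w" using w1 by (intro mult_right_mono) auto
        then show ?thesis by (simp add: mult_ac)
      qed
      finally show ?thesis using diff c\<Phi> by linarith
    qed
    have "minimax_ge_whp n (design_measure d Q) \<mu> (sparse_additive_class d s (unit_ball H ip))
        (real s * (1\<^sup>2 * \<epsilon>\<^sup>2 / 4) / 8)"
      by (rule minimax_ge_whp_two_scales[OF M(1,2) M'(1,2) \<epsilon> \<eta>(1) _ _ rad large s]) auto
    moreover have "real s * (1\<^sup>2 * \<epsilon>\<^sup>2 / 4) / 8 = \<kappa>\<^sup>2 / 32 * (real s * (1 / real n) powr (2 * \<alpha> / (2 * \<alpha> + 1)))"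
      unfolding p2[symmetric] \<epsilon>_def by (simp add: power_mult_distrib)
    ultimately show "minimax_ge_whp n (design_measure d Q) \<mu> (sparse_additive_class d s (unit_ball H ip))
        (\<kappa>\<^sup>2 / 32 * (real s * (1 / real n) powr (2 * \<alpha> / (2 * \<alpha> + 1))))"
      by (simp only:)
  qed
qed

text \<open>Half a sum is at most the larger summand, so one of the two bounds alone suffices and no
  events have to be intersected.\<close>

lemma (in prob_space) minimax_ge_whp_add:
  assumes "minimax_ge_whp n M \<mu> F (C1 * a)" "minimax_ge_whp n M \<mu> F (C2 * b)"
    and F: "F \<subseteq> borel_measurable M" and "0 \<le> a" "0 \<le> b" and "C \<le> C1 / 2" "C \<le> C2 / 2"
  shows "minimax_ge_whp n M \<mu> F (C * (a + b))"
proof -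
  have "C * a \<le> C1 / 2 * a" "C * b \<le> C2 / 2 * b"
    using assms(4-7) by (simp_all only: mult_right_mono)
  then have "C * (a + b) \<le> (C1 * a + C2 * b) / 2"
    by (simp add: distrib_left)
  moreover have "x \<le> p \<or> x \<le> q" if "x \<le> (p + q) / 2" for x p q :: real
    using that by (cases "p \<le> q") auto
  ultimately have "C * (a + b) \<le> C1 * a \<or> C * (a + b) \<le> C2 * b" by blast
  then show ?thesis using minimax_ge_whp_mono[OF _ F] assms(1,2) by blast
qed

theorem theorem2:
  fixes c\<^sub>1 c\<^sub>2 e\<^sub>0 \<alpha> K :: real
  assumes "0 < c\<^sub>1" and "0 < c\<^sub>2" and "0 < e\<^sub>0" and "e\<^sub>0 \<le> 1" and "0 < \<alpha>" and "0 < K"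
  shows "\<exists>C>0. \<forall>(X :: real set) H ip Q. centred_rkhs X H ip Q \<longrightarrow>
    (\<forall>(n::nat) (d::nat) (s::nat) (\<mu>::real).
       1 \<le> n \<longrightarrow> 1 \<le> s \<longrightarrow> real s \<le> real d / 4 \<longrightarrow> ln (real d / real s) \<le> K * real n \<longrightarrow>
         (\<forall>m>0. log_entropy e\<^sub>0 c\<^sub>1 c\<^sub>2 (unit_ball H ip) (L2_dist Q) m \<longrightarrow> m \<le> K * real n \<longrightarrow>
            minimax_ge_whp n (design_measure d Q) \<mu> (sparse_additive_class d s (unit_ball H ip))
              (C * (real s * ln (real d / real s) / real n + real s * (m / real n)))) \<and>
         (poly_entropy e\<^sub>0 c\<^sub>1 c\<^sub>2 (unit_ball H ip) (L2_dist Q) \<alpha> \<longrightarrow>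
            minimax_ge_whp n (design_measure d Q) \<mu> (sparse_additive_class d s (unit_ball H ip))
              (C * (real s * ln (real d / real s) / real n
                    + real s * (1 / real n) powr (2 * \<alpha> / (2 * \<alpha> + 1))))))"
proof -
  \<comment> \<open>The norm \<open>e\<^sub>0 / 4\<close> comes from a packing at scale
    \<open>e\<^sub>0 / 2\<close>, inside the range of the entropy hypothesis.\<close>
  define C1 where "C1 = min (1 / 32) ((e\<^sub>0 / 4)\<^sup>2 / K) / 2 ^ 52"
  have C1: "0 < C1" using assms by (simp add: C1_def)
  obtain C2 where C2: "0 < C2"
    and log: "\<And>X H ip Q n d s \<mu> m. centred_rkhs X H ip Q \<Longrightarrow> 1 \<le> n \<Longrightarrow> 1 \<le> s \<Longrightarrow> s \<le> d \<Longrightarrow> 0 < m \<Longrightarrow>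
      log_entropy e\<^sub>0 c\<^sub>1 c\<^sub>2 (unit_ball H ip) (L2_dist Q) m \<Longrightarrow> m \<le> K * real n \<Longrightarrow>
      minimax_ge_whp n (design_measure d Q) \<mu> (sparse_additive_class d s (unit_ball H ip))
        (C2 * (real s * (m / real n)))"
    using minimax_log_entropy[OF assms(1,2,3,4,6)] by blast
  obtain C3 where C3: "0 < C3"
    and poly: "\<And>X H ip Q n d s \<mu>. centred_rkhs X H ip Q \<Longrightarrow> 1 \<le> n \<Longrightarrow> 1 \<le> s \<Longrightarrow> s \<le> d \<Longrightarrow>
      poly_entropy e\<^sub>0 c\<^sub>1 c\<^sub>2 (unit_ball H ip) (L2_dist Q) \<alpha> \<Longrightarrow>
      minimax_ge_whp n (design_measure d Q) \<mu> (sparse_additive_class d s (unit_ball H ip))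
        (C3 * (real s * (1 / real n) powr (2 * \<alpha> / (2 * \<alpha> + 1))))"
    using minimax_poly_entropy[OF assms(1,2,3,5)] by blast
  define C where "C = min C1 (min C2 C3) / 2"
  have C: "0 < C" "C \<le> C1 / 2" "C \<le> C2 / 2" "C \<le> C3 / 2"
    using C1 C2 C3 by (auto simp: C_def)
  show ?thesis
  proof (intro exI[of _ C] conjI C(1) allI impI)
    fix X H ip Q and n d s :: nat and \<mu> :: real
    assume rk: "centred_rkhs X H ip Q" and n: "1 \<le> n" and s: "1 \<le> s" and sd: "real s \<le> real d / 4"
      and lnK: "ln (real d / real s) \<le> K * real n"
    interpret centred_rkhs X H ip Q by (rule rk)
    interpret P: prob_space "design_measure d Q" by (rule prob_space_design_measure)
    have sled: "s \<le> d" using sd by simp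
    have a0: "0 \<le> real s * ln (real d / real s) / real n" using s sd by simp
    \<comment> \<open>The sparsity term only needs two separated functions at one scale, so a
      general \<open>\<phi>\<close> serves both entropy regimes.\<close>
    have sparse: "minimax_ge_whp n (design_measure d Q) \<mu> (sparse_additive_class d s (unit_ball H ip))
        (C1 * (real s * ln (real d / real s) / real n))"
      if ent: "entropy_order e\<^sub>0 c\<^sub>1 c\<^sub>2 (unit_ball H ip) (L2_dist Q) \<phi>" and \<phi>: "0 < \<phi> (e\<^sub>0 / 2)" for \<phi>
    proof -
      have "2 * (e\<^sub>0 / 4) = e\<^sub>0 / 2" by simp
      then obtain M where "packing_number (2 * (e\<^sub>0 / 4)) (unit_ball H ip) (L2_dist Q) = enat M" "2 \<le> M"
        using entropy_orderE[OF ent, of "e\<^sub>0 / 2"] \<phi> assms by auto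
      then obtain g where "g \<in> unit_ball H ip" "(\<integral>x. (g x)\<^sup>2 \<partial>Q) = (e\<^sub>0 / 4)\<^sup>2"
        using unit_ball_element_of_norm assms(3) by (metis divide_pos_pos zero_less_numeral)
      then show ?thesis
        unfolding C1_def by (rule minimax_ge_whp_sparse) (use assms n s sd lnK in auto)
    qed
    {
      fix m :: real
      assume m: "0 < m" and ent: "log_entropy e\<^sub>0 c\<^sub>1 c\<^sub>2 (unit_ball H ip) (L2_dist Q) m" and mK: "m \<le> K * real n"
      have "0 < m * ln (1 / (e\<^sub>0 / 2))" using m assms by simp
      note sparse[OF ent[unfolded log_entropy_def] this]
      from P.minimax_ge_whp_add[OF this log[OF rk n s sled m ent mK]
          sparse_additive_class_measurable a0 _ C(2,3)] m
      show "minimax_ge_whp n (design_measure d Q) \<mu> (sparse_additive_class d s (unit_ball H ip))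
              (C * (real s * ln (real d / real s) / real n + real s * (m / real n)))"
        by simp
    next
      assume ent: "poly_entropy e\<^sub>0 c\<^sub>1 c\<^sub>2 (unit_ball H ip) (L2_dist Q) \<alpha>"
      have "0 < (1 / (e\<^sub>0 / 2)) powr (1 / \<alpha>)" using assms by simp
      note sparse[OF ent[unfolded poly_entropy_def] this]
      from P.minimax_ge_whp_add[OF this poly[OF rk n s sled ent]
          sparse_additive_class_measurable a0 _ C(2,4)]
      show "minimax_ge_whp n (design_measure d Q) \<mu> (sparse_additive_class d s (unit_ball H ip))
              (C * (real s * ln (real d / real s) / real n
                    + real s * (1 / real n) powr (2 * \<alpha> / (2 * \<alpha> + 1))))"
        by simp
    }
  qed
qed

end
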